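(* Let $0<\beta<1$. (i) For all $x>0$ and all real $\nu\leq\tfrac12$, $$\int_x^\infty \mathrm{e}^{\beta t}t^\nu K_\nu(t)\,\mathrm{d}t\leq\frac{1}{1-\beta}\mathrm{e}^{\beta x}x^\nu K_{\nu}(x),$$ with equality if and only if $\nu=\frac{1}{2}$; the inequality is reversed if $\nu>\frac{1}{2}$. (ii) Let $\nu>\frac{1}{2}$. Then the following double inequality holds for all $x>0$: $$\frac{1}{1-\beta}\mathrm{e}^{\beta x}x^\nu K_{\nu}(x)<\int_x^\infty \mathrm{e}^{\beta t}t^\nu K_\nu(t)\,\mathrm{d}t<\frac{I_{\nu,\beta}}{2^{\nu-1}\Gamma(\nu)}\mathrm{e}^{\beta x}x^\nu K_{\nu}(x).$$ The constants $\frac{1}{1-\beta}$ in the lower bound and $\frac{I_{\nu,\beta}}{2^{\nu-1}\Gamma(\nu)}$ in the upper bound cannot be improved. (iii) Let $\nu\geq-\frac{1}{2}$. Then the following double inequality holds for all $x>0$: $$\frac{1}{1-\beta}\mathrm{e}^{\beta x}x^{\nu+1} K_{\nu+1}(x)\leq\int_x^\infty \mathrm{e}^{\beta t}t^{\nu+1} K_\nu(t)\,\mathrm{d}t<\bigg(1+\frac{\beta I_{\nu+1,\beta}}{2^\nu \Gamma(\nu+1)}\bigg)\mathrm{e}^{\beta x}x^{\nu+1} K_{\nu+1}(x).$$ Equality holds in the lower bound if and only if $\nu=-\frac{1}{2}$. The constants $\frac{1}{1-\beta}$ in the lower bound and $1+\frac{\beta I_{\nu+1,\beta}}{2^\nu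 \Gamma(\nu+1)}$ in the upper bound cannot be improved.
   Context: $K_\nu$ denotes the modified Bessel function of the second kind of real order $\nu$, and $\Gamma$ is the gamma function. For $\nu>-\frac{1}{2}$ and $-1<\beta<1$, define $$I_{\nu,\beta}:=\int_0^\infty \mathrm{e}^{\beta t}t^\nu K_\nu(t)\,\mathrm{d}t.$$ (This is a constant depending on $\nu$ and $\beta$, not a Bessel function.) That a constant "cannot be improved" means that, for fixed $\nu$ and $\beta$, the inequality does not hold for all $x>0$ if the constant is replaced by a larger one independent of $x$ (for a lower bound) or by a smaller one independent of $x$ (for an upper bound).
   Formalization: In (iii) the strict upper bound is false at ν = −1/2, where both constants equal 1/(1−β) and both bounds are equalities; the formal theorem proves ≤ for all ν ≥ −1/2 and strict < for ν > −1/2. *)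

theory Defs
  imports "HOL-Analysis.Analysis"
begin

text \<open>
  Modified Bessel function of the second kind, of real order and positive argument, defined by
  the standard integral (DLMF 10.32.9), which converges absolutely for every real order
  when \<open>x > 0\<close>.  Values at \<open>x \<le> 0\<close> are meaningless and not used.
\<close>

definition besselK :: "real \<Rightarrow> real \<Rightarrow> real" where
  "besselK \<nu> x = (LBINT u:{0..}. exp (- x * cosh u) * cosh (\<nu> * u))"

text \<open>The constant \<open>I\<^bsub>\<nu>,\<beta>\<^esub>\<close>, meaningful for \<open>\<nu> > -1/2\<close> and \<open>-1 < \<beta> < 1\<close>.\<close>

definition besselK_const :: "real \<Rightarrow> real \<Rightarrow> real" where
  "besselK_const \<nu> \<beta> = (LBINT t:{0<..}. exp (\<beta> * t) * t powr \<nu> * besselK \<nu> t)"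

end

theory Submission
  imports Defs
begin

text \<open>
  Write \<open>f(t) = e\<^bsup>\<beta>t\<^esup> t\<^sup>\<nu> K\<^sub>\<nu>(t)\<close>, \<open>g(t) = e\<^bsup>\<beta>t\<^esup> t\<^sup>\<nu> K\<^bsub>\<nu>-1\<^esub>(t)\<close> and \<open>F(x) = \<integral>\<^sub>x\<^sup>\<infinity> f\<close>.
  Since \<open>(t\<^sup>\<nu> K\<^sub>\<nu>)' = - t\<^sup>\<nu> K\<^bsub>\<nu>-1\<^esub>\<close>, one has \<open>f' = \<beta> f - g\<close>, and as \<open>f\<close> vanishes at
  infinity this gives, for every constant \<open>c\<close>,
  \<open>F(x) - c f(x) = \<integral>\<^sub>x\<^sup>\<infinity> ((1 + c \<beta>) f - c g)\<close>  (\<open>tail_minus_weighted_besselK\<close>).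
  Every claim about the ratio \<open>F / f\<close> is a claim about the sign of this integral, whose
  integrand is \<open>f\<close> times \<open>1 + c \<beta> - c r\<close> with \<open>r = K\<^bsub>\<nu>-1\<^esub> / K\<^sub>\<nu>\<close>.

  For \<open>c = 1/(1-\<beta>)\<close> the integrand is \<open>c (f - g)\<close>. Because \<open>K\<^sub>\<nu>\<close> increases with
  \<open>\<bar>\<nu>\<bar>\<close>, its sign is that of \<open>\<nu> - 1/2\<close>, and it vanishes identically at \<open>\<nu> = 1/2\<close>. This is (i)
  and the lower bound in (ii). A larger \<open>c\<close> fails for large \<open>x\<close>, because the three-term
  recurrence forces \<open>r \<rightarrow> 1\<close>, so that the integrand is eventually negative.

  For the upper bound take \<open>c = C = I\<^bsub>\<nu>,\<beta>\<^esub> / (2\<^bsup>\<nu>-1\<^esup> \<Gamma>(\<nu>))\<close>, which is the value of \<open>F / f\<close> at \<open>0\<close>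
  because \<open>t\<^sup>\<nu> K\<^sub>\<nu>(t) \<rightarrow> 2\<^bsup>\<nu>-1\<^esup> \<Gamma>(\<nu>)\<close>; hence no smaller constant works, and the integral
  over all of \<open>(0,\<infinity>)\<close> is \<open>0\<close>. For \<open>\<nu> > 1/2\<close> the ratio \<open>r\<close> is strictly increasing
  (\<open>besselK_ratio_strict_mono\<close>), so the integrand changes sign at most once, from positive
  to negative. An integrand of that shape with total integral \<open>0\<close> has negative integral over
  every tail, which is \<open>F < C f\<close>.

  Part (iii) is the case of order \<open>\<nu> + 1\<close> of parts (i) and (ii): the relation \<open>f' = \<beta> f - g\<close>
  also says that \<open>\<integral>\<^sub>x\<^sup>\<infinity> g = f(x) + \<beta> F(x)\<close>, so bounds of \<open>F\<close> by \<open>d f\<close> and bounds of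
  \<open>\<integral>\<^sub>x\<^sup>\<infinity> g\<close> by \<open>(1 + \<beta> d) f\<close> are equivalent.
\<close>

section \<open>Integrals over half lines\<close>

text \<open>
  Strictness in the integral inequalities below comes from here: a nonnegative integrand that is
  positive on some interval has positive integral.
\<close>

lemma set_lebesgue_integral_strict_pos:
  fixes f :: "real \<Rightarrow> real"
  assumes "set_integrable lborel A f" "\<And>x. x \<in> A \<Longrightarrow> 0 \<le> f x"
    and "{a<..<b} \<subseteq> A" "a < b" "\<And>x. x \<in> {a<..<b} \<Longrightarrow> 0 < f x"
  shows "0 < (LBINT x:A. f x)"
proof (rule ccontr)
  let ?g = "\<lambda>x. indicat_real A x *\<^sub>R f x"
  have nn: "AE x in lborel. 0 \<le> ?g x"
    using assms(2) by (auto simp: indicator_def)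
  assume "\<not> ?thesis"
  moreover have "0 \<le> integral\<^sup>L lborel ?g"
    using nn by (rule integral_nonneg_AE)
  ultimately have "integral\<^sup>L lborel ?g = 0"
    by (simp add: set_lebesgue_integral_def)
  then have "AE x in lborel. ?g x = 0"
    using integral_nonneg_eq_0_iff_AE[OF _ nn] assms(1) by (simp add: set_integrable_def)
  then have "AE x in lborel. x \<notin> {a<..<b}"
    by eventually_elim (use assms(3,5) in \<open>force simp: indicator_def\<close>)
  then have "emeasure lborel {a<..<b} = 0"
    by (subst (asm) AE_iff_measurable[of "{a<..<b}"]) auto
  then show False
    using \<open>a < b\<close> by simp
qed

text \<open>
  The fundamental theorem of calculus on a half line. Only the one-sided limit of the
  antiderivative is used at the left end, so that it also applies at the singular point \<open>0\<close>.
\<close>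

lemma set_integral_greaterThan_FTC:
  fixes F f :: "real \<Rightarrow> real"
  assumes "\<And>t. a < t \<Longrightarrow> (F has_real_derivative f t) (at t)"
    and "\<And>t. a < t \<Longrightarrow> isCont f t"
    and "set_integrable lborel {a<..} f"
    and "(F \<longlongrightarrow> A) (at_right a)" "(F \<longlongrightarrow> B) at_top"
  shows "(LBINT t:{a<..}. f t) = B - A"
proof -
  have "(LBINT t=ereal a..\<infinity>. f t) = B - A"
    by (rule interval_integral_FTC_integrable[where F = F])
       (use assms in \<open>auto simp: has_real_derivative_iff_has_vector_derivative[symmetric]
          ereal_tendsto_simps\<close>)
  then show ?thesis
    by (simp add: interval_integral_to_infinity_eq)
qed

text \<open>
  As \<open>cosh u \<ge> u\<^sup>2 / 4\<close>, completing the square in \<open>x u\<^sup>2 / 4 - b u + b\<^sup>2 / x = (x u / 2 - b)\<^sup>2 / x\<close>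
  shows that the kernel decays faster than every exponential.
\<close>

section \<open>Integrability and differentiability of the Bessel integral\<close>

lemma exp_minus_cosh_le:
  fixes x b u :: real
  assumes "0 < x" "0 \<le> u"
  shows "exp (- x * cosh u) \<le> exp (b\<^sup>2 / x) * exp (- b * u)"
proof -
  have "1 + u + u\<^sup>2 / 2 \<le> exp u"
    using exp_lower_Taylor_quadratic[OF assms(2)] .
  moreover have "exp u / 2 \<le> cosh u"
    by (simp add: cosh_field_def)
  ultimately have "u\<^sup>2 / 4 \<le> cosh u"
    using \<open>0 \<le> u\<close> by linarith
  then have "x * u\<^sup>2 / 4 \<le> x * cosh u"
    using \<open>0 < x\<close> by (simp add: mult.assoc mult_left_mono)
  moreover have "0 \<le> (x * u / 2 - b)\<^sup>2 / x"
    using \<open>0 < x\<close> by simp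
  then have "0 \<le> x * u\<^sup>2 / 4 - b * u + b\<^sup>2 / x"
    using \<open>0 < x\<close> by (simp add: power2_eq_square field_simps)
  ultimately show ?thesis
    by (simp flip: exp_add)
qed

lemma set_integrable_exp_minus:
  assumes "0 < (a::real)"
  shows "set_integrable lborel {c..} (\<lambda>u. exp (- a * u))"
proof -
  have "(\<lambda>u. exp (- a * u)) absolutely_integrable_on {c..}"
    by (rule nonnegative_absolutely_integrable_1[OF integrable_on_exp_minus_to_infinity[OF assms]]) auto
  then show ?thesis
    unfolding set_integrable_def by (subst (asm) integrable_completion) auto
qed

lemma set_integrable_exp_minus_cosh:
  fixes x b :: real
  assumes "0 < x"
  shows "set_integrable lborel {0..} (\<lambda>u. exp (- x * cosh u) * exp (b * u))"
proof (rule set_integrable_bound)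
  show "set_integrable lborel {0..} (\<lambda>u. exp ((b + 1)\<^sup>2 / x) * exp (- 1 * u))"
    by (intro set_integrable_mult_right set_integrable_exp_minus) simp
  show "set_borel_measurable lborel {0..} (\<lambda>u. exp (- x * cosh u) * exp (b * u))"
    unfolding set_borel_measurable_def cosh_field_def by measurable
  have "exp (- x * cosh u) * exp (b * u) \<le> exp ((b + 1)\<^sup>2 / x) * exp (- 1 * u)" if "0 \<le> u" for u
  proof -
    have "exp (- x * cosh u) * exp (b * u)
        \<le> (exp ((b + 1)\<^sup>2 / x) * exp (- (b + 1) * u)) * exp (b * u)"
      using exp_minus_cosh_le[OF assms that, of "b + 1"] by (intro mult_right_mono) auto
    also have "\<dots> = exp ((b + 1)\<^sup>2 / x) * exp (- 1 * u)"
      by (simp add: algebra_simps flip: exp_add)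
    finally show ?thesis .
  qed
  then show "AE u in lborel. u \<in> {0..} \<longrightarrow> norm (exp (- x * cosh u) * exp (b * u))
      \<le> norm (exp ((b + 1)\<^sup>2 / x) * exp (- 1 * u))"
    by (auto simp: abs_mult)
qed

lemma set_integrable_besselK:
  fixes x \<nu> :: real
  assumes "0 < x"
  shows "set_integrable lborel {0..} (\<lambda>u. exp (- x * cosh u) * cosh (\<nu> * u))"
proof -
  have "set_integrable lborel {0..} (\<lambda>u. exp (- x * cosh u) * exp (\<nu> * u) * (1/2)
      + exp (- x * cosh u) * exp (- \<nu> * u) * (1/2))"
    using assms by (intro set_integral_add(1) set_integrable_mult_left set_integrable_exp_minus_cosh)
  then show ?thesis
    by (simp add: cosh_field_def field_simps)
qed

lemma cosh_mult_cosh: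
  "cosh (u::real) * cosh (\<nu> * u) = (cosh ((\<nu> + 1) * u) + cosh ((\<nu> - 1) * u)) / 2"
  by (simp add: cosh_field_def field_simps flip: exp_add)

text \<open>
  The product formula for \<open>cosh\<close> turns the factor \<open>cosh u\<close>, which differentiation in \<open>x\<close>
  produces, into a shift of the order by one in both directions.
\<close>

lemma set_integral_cosh_besselK:
  assumes "0 < x"
  shows "set_integrable lborel {0..} (\<lambda>u. exp (- x * cosh u) * (cosh u * cosh (\<nu> * u)))" (is ?I)
    and "(LBINT u:{0..}. exp (- x * cosh u) * (cosh u * cosh (\<nu> * u)))
       = (besselK (\<nu> + 1) x + besselK (\<nu> - 1) x) / 2" (is ?E)
proof -
  have eq: "exp (- x * cosh u) * (cosh u * cosh (\<nu> * u)) =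
      (exp (- x * cosh u) * cosh ((\<nu> + 1) * u) + exp (- x * cosh u) * cosh ((\<nu> - 1) * u)) / 2" for u
    unfolding cosh_mult_cosh by (simp add: field_simps)
  show ?I ?E
    unfolding eq besselK_def
    using set_integral_add[OF set_integrable_besselK[OF assms] set_integrable_besselK[OF assms]]
    by auto
qed

text \<open>
  For \<open>c = cosh u\<close>, the first-order Taylor remainder of the kernel in \<open>x\<close> is bounded by \<open>h\<^sup>2\<close> times a function
  that is still integrable in \<open>u\<close> and does not depend on \<open>h\<close>. Restricting to \<open>\<bar>h\<bar> \<le> x / 2\<close>
  leaves half of the exponential decay.
\<close>

lemma exp_minus_Taylor_bound:
  fixes c h x :: real
  assumes "0 \<le> c" "\<bar>h\<bar> \<le> x / 2"
  shows "\<bar>exp (- (x + h) * c) - exp (- x * c) + h * (exp (- x * c) * c)\<bar>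
    \<le> h\<^sup>2 * (exp (- (x / 2) * c) * c\<^sup>2)"
proof -
  define y where "y = - h * c"
  have "\<bar>exp y - 1 - y\<bar> \<le> y\<^sup>2 * exp \<bar>y\<bar>"
  proof -
    obtain t where t: "\<bar>t\<bar> \<le> \<bar>y\<bar>" "exp y = (\<Sum>m<2. y ^ m / fact m) + exp t / fact 2 * y ^ 2"
      using Maclaurin_exp_le[of y 2] by blast
    then have "exp y - 1 - y = exp t / 2 * y\<^sup>2"
      by (simp add: numeral_2_eq_2)
    moreover have "exp t / 2 \<le> exp \<bar>y\<bar>"
      using t(1) exp_le_cancel_iff[of t "\<bar>y\<bar>"] exp_gt_zero[of t] by (smt (verit) field_sum_of_halves)
    ultimately show ?thesis
      using mult_right_mono[of "exp t / 2" "exp \<bar>y\<bar>" "y\<^sup>2"]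
      by (simp add: abs_mult mult.commute del: eq_divide_eq_numeral1 divide_le_eq_numeral1)
  qed
  then have "exp (- x * c) * \<bar>exp y - 1 - y\<bar> \<le> exp (- x * c) * (y\<^sup>2 * exp \<bar>y\<bar>)"
    by (intro mult_left_mono) auto
  also have "\<dots> = y\<^sup>2 * exp (- x * c + \<bar>y\<bar>)"
    by (subst exp_add) simp
  also have "\<dots> \<le> y\<^sup>2 * exp (- (x / 2) * c)"
  proof -
    have "\<bar>y\<bar> \<le> x / 2 * c"
      using assms by (simp add: y_def abs_mult mult_right_mono del: times_divide_eq_left)
    then show ?thesis by (intro mult_left_mono) auto
  qed
  also have "\<dots> = h\<^sup>2 * (exp (- (x / 2) * c) * c\<^sup>2)"
    by (simp add: y_def power_mult_distrib)
  also have "exp (- x * c) * \<bar>exp y - 1 - y\<bar> = \<bar>exp (- x * c) * (exp y - 1 - y)\<bar>"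
    by (simp add: abs_mult)
  also have "exp (- x * c) * (exp y - 1 - y)
      = exp (- (x + h) * c) - exp (- x * c) + h * (exp (- x * c) * c)"
    by (simp add: y_def algebra_simps flip: exp_add)
  finally show ?thesis .
qed

lemma has_real_derivative_quadratic_remainder:
  fixes f :: "real \<Rightarrow> real"
  assumes "0 < d" "\<And>h. \<bar>h\<bar> \<le> d \<Longrightarrow> \<bar>f (x + h) - f x - h * D\<bar> \<le> M * h\<^sup>2"
  shows "(f has_real_derivative D) (at x)"
  unfolding DERIV_def
proof (rule Lim_transform_bound[where g = "\<lambda>h. M * \<bar>h\<bar>" and f = "\<lambda>h. (f (x + h) - f x) / h - D", THEN LIM_zero_cancel])
  show "\<forall>\<^sub>F h in at 0. norm ((f (x + h) - f x) / h - D) \<le> norm (M * \<bar>h\<bar>)"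
    unfolding eventually_at
  proof (intro exI[of _ d] conjI ballI impI)
    fix h :: real assume h: "h \<noteq> 0 \<and> dist h 0 < d"
    have "(f (x + h) - f x) / h - D = (f (x + h) - f x - h * D) / h"
      using h by (simp add: field_simps)
    then have "\<bar>(f (x + h) - f x) / h - D\<bar> \<le> M * h\<^sup>2 / \<bar>h\<bar>"
      using assms(2)[of h] h by (simp add: divide_right_mono)
    also have "\<dots> = M * \<bar>h\<bar>"
      using h by (simp add: power2_eq_square field_simps abs_if)
    finally show "norm ((f (x + h) - f x) / h - D) \<le> norm (M * \<bar>h\<bar>)"
      by simp
  qed (use assms in auto)
  show "((\<lambda>h. M * \<bar>h\<bar>) \<longlongrightarrow> 0) (at 0)"
    by (auto intro!: tendsto_eq_intros)
qed

text \<open>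
  Differentiation under the integral sign: integrating the Taylor bound of the kernel gives a
  quadratic remainder for \<open>besselK\<close> itself.
\<close>

lemma has_real_derivative_besselK:
  assumes "0 < x"
  shows "(besselK \<nu> has_real_derivative - (besselK (\<nu> + 1) x + besselK (\<nu> - 1) x) / 2) (at x)"
proof (rule has_real_derivative_quadratic_remainder)
  show "0 < x / 2" using assms by simp
  let ?M = "LBINT u:{0..}. exp (- (x / 2) * cosh u) * ((cosh u)\<^sup>2 * cosh (\<nu> * u))"
  have M: "set_integrable lborel {0..} (\<lambda>u. exp (- (x / 2) * cosh u) * ((cosh u)\<^sup>2 * cosh (\<nu> * u)))"
  proof -
    have eq: "exp (- (x / 2) * cosh u) * ((cosh u)\<^sup>2 * cosh (\<nu> * u)) =
      exp (- (x / 2) * cosh u) * (cosh u * cosh ((\<nu> + 1) * u)) * (1/2)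
        + exp (- (x / 2) * cosh u) * (cosh u * cosh ((\<nu> - 1) * u)) * (1/2)" for u :: real
    proof -
      have "(cosh u)\<^sup>2 * cosh (\<nu> * u)
          = cosh u * cosh ((\<nu> + 1) * u) * (1/2) + cosh u * cosh ((\<nu> - 1) * u) * (1/2)"
        using arg_cong[OF cosh_mult_cosh[of u \<nu>], of "(*) (cosh u)"]
        by (simp only: power2_eq_square mult.assoc) (simp add: field_simps)
      then show ?thesis by (simp only: distrib_left mult.assoc)
    qed
    show ?thesis
      unfolding eq using assms
      by (intro set_integral_add(1) set_integrable_mult_left set_integral_cosh_besselK(1)) auto
  qed
  fix h assume h: "\<bar>h\<bar> \<le> x / 2"
  then have pos: "0 < x + h" using assms by linarith
  let ?R = "\<lambda>u. exp (- (x + h) * cosh u) * cosh (\<nu> * u) - exp (- x * cosh u) * cosh (\<nu> * u)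
      + h * (exp (- x * cosh u) * (cosh u * cosh (\<nu> * u)))"
  note int = set_integrable_besselK[OF pos, of \<nu>] set_integrable_besselK[OF assms, of \<nu>]
    set_integral_cosh_besselK(1)[OF assms, of \<nu>]
  have R: "set_integrable lborel {0..} ?R"
    by (intro set_integral_add(1) set_integral_diff(1) set_integrable_mult_right int)
  have "(LBINT u:{0..}. ?R u)
      = besselK \<nu> (x + h) - besselK \<nu> x + h * ((besselK (\<nu> + 1) x + besselK (\<nu> - 1) x) / 2)"
    by (simp only: set_integral_add(2) set_integral_diff set_integrable_mult_right int
        set_integral_mult_right set_integral_cosh_besselK(2)[OF assms] besselK_def[of \<nu>, symmetric])
  then have "\<bar>besselK \<nu> (x + h) - besselK \<nu> x
      - h * (- (besselK (\<nu> + 1) x + besselK (\<nu> - 1) x) / 2)\<bar> = \<bar>LBINT u:{0..}. ?R u\<bar>"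
    by argo
  also have "\<dots> \<le> (LBINT u:{0..}. \<bar>?R u\<bar>)"
    using set_integral_norm_bound[OF R] by simp
  also have "\<dots> \<le> (LBINT u:{0..}. h\<^sup>2 * (exp (- (x / 2) * cosh u) * ((cosh u)\<^sup>2 * cosh (\<nu> * u))))"
  proof (rule set_integral_mono)
    show "set_integrable lborel {0..} (\<lambda>u. \<bar>?R u\<bar>)"
      using R by (rule set_integrable_abs)
    show "set_integrable lborel {0..}
        (\<lambda>u. h\<^sup>2 * (exp (- (x / 2) * cosh u) * ((cosh u)\<^sup>2 * cosh (\<nu> * u))))"
      using M by (rule set_integrable_mult_right)
    fix u :: real
    have "?R u = (exp (- (x + h) * cosh u) - exp (- x * cosh u) + h * (exp (- x * cosh u) * cosh u))
        * cosh (\<nu> * u)"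
      by (simp only: left_diff_distrib distrib_right mult.assoc)
    then have "\<bar>?R u\<bar> = \<bar>exp (- (x + h) * cosh u) - exp (- x * cosh u) + h * (exp (- x * cosh u) * cosh u)\<bar>
        * cosh (\<nu> * u)"
      by (simp only: abs_mult abs_of_nonneg[OF cosh_real_nonneg])
    also have "\<dots> \<le> h\<^sup>2 * (exp (- (x / 2) * cosh u) * (cosh u)\<^sup>2) * cosh (\<nu> * u)"
      using h by (intro mult_right_mono exp_minus_Taylor_bound) auto
    finally show "\<bar>?R u\<bar> \<le> h\<^sup>2 * (exp (- (x / 2) * cosh u) * ((cosh u)\<^sup>2 * cosh (\<nu> * u)))"
      by (simp add: mult.assoc)
  qed
  also have "\<dots> = ?M * h\<^sup>2"
    by simp
  finally show "\<bar>besselK \<nu> (x + h) - besselK \<nu> x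
      - h * (- (besselK (\<nu> + 1) x + besselK (\<nu> - 1) x) / 2)\<bar> \<le> ?M * h\<^sup>2" .
qed

section \<open>Order, decay and recurrence\<close>

lemma besselK_greaterThan:
  "besselK \<nu> x = (LBINT u:{0<..}. exp (- x * cosh u) * cosh (\<nu> * u))"
  unfolding besselK_def by (rule set_integral_discrete_difference[of "{0}"]) auto

lemma besselK_minus: "besselK (- \<nu>) x = besselK \<nu> x"
  by (simp add: besselK_def)

lemma besselK_pos:
  assumes "0 < x"
  shows "0 < besselK \<nu> x"
  unfolding besselK_def
  by (rule set_lebesgue_integral_strict_pos[where a = 0 and b = 1, OF set_integrable_besselK[OF assms]]) auto

lemma besselK_strict_mono_order:
  assumes "0 < x" "\<bar>\<mu>\<bar> < \<bar>\<nu>\<bar>"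
  shows "besselK \<mu> x < besselK \<nu> x"
proof -
  have less: "cosh (\<mu> * u) < cosh (\<nu> * u)" if "0 < u" for u
  proof -
    have "cosh \<bar>\<mu> * u\<bar> < cosh \<bar>\<nu> * u\<bar>"
      using that assms by (subst cosh_real_nonneg_less_iff) (auto simp: abs_mult)
    then show ?thesis by simp
  qed
  have "0 < (LBINT u:{0..}. exp (- x * cosh u) * cosh (\<nu> * u) - exp (- x * cosh u) * cosh (\<mu> * u))"
  proof (rule set_lebesgue_integral_strict_pos)
    show "0 \<le> exp (- x * cosh u) * cosh (\<nu> * u) - exp (- x * cosh u) * cosh (\<mu> * u)"
      if "u \<in> {0..}" for u
      using that less[of u] by (cases "u = 0") auto
    show "0 < exp (- x * cosh u) * cosh (\<nu> * u) - exp (- x * cosh u) * cosh (\<mu> * u)"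
      if "u \<in> {0<..<1}" for u
      using that less[of u] by auto
  qed (use assms in \<open>auto intro!: set_integral_diff(1) set_integrable_besselK[OF assms(1), simplified]\<close>)
  then show ?thesis
    using set_integrable_besselK[OF assms(1)] by (simp add: set_integral_diff besselK_def)
qed

text \<open>
  This follows from \<open>cosh u \<ge> 1\<close>, and suffices to beat the factor \<open>exp (\<beta> * t)\<close> when \<open>\<beta> < 1\<close>.
\<close>

lemma besselK_exponential_decay:
  assumes "0 < x" "x \<le> y"
  shows "besselK \<nu> y \<le> exp (x - y) * besselK \<nu> x"
proof -
  have "besselK \<nu> y \<le> (LBINT u:{0..}. exp (x - y) * (exp (- x * cosh u) * cosh (\<nu> * u)))"
    unfolding besselK_def
  proof (intro set_integral_mono set_integrable_mult_right set_integrable_besselK)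
    fix u :: real
    have "(y - x) * 1 \<le> (y - x) * cosh u"
      using assms by (intro mult_left_mono cosh_real_ge_1) auto
    then have "exp (- y * cosh u) \<le> exp (x - y) * exp (- x * cosh u)"
      by (simp add: algebra_simps flip: exp_add)
    from mult_right_mono[OF this, of "cosh (\<nu> * u)"]
    show "exp (- y * cosh u) * cosh (\<nu> * u) \<le> exp (x - y) * (exp (- x * cosh u) * cosh (\<nu> * u))"
      by (simp add: mult.assoc)
  qed (use assms in auto)
  then show ?thesis
    by (simp add: besselK_def)
qed

text \<open>
  Integration by parts: \<open>exp (- x * cosh u) * sinh (\<nu> * u)\<close> vanishes at \<open>0\<close> and at infinity, so the
  integral of its derivative is zero, and \<open>sinh u * sinh (\<nu> * u)\<close> is half the difference of the
  \<open>cosh\<close> of orders \<open>\<nu> + 1\<close> and \<open>\<nu> - 1\<close>.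
\<close>

lemma besselK_recurrence:
  assumes "0 < x"
  shows "x * (besselK (\<nu> + 1) x - besselK (\<nu> - 1) x) = 2 * \<nu> * besselK \<nu> x"
proof -
  let ?F = "\<lambda>u. exp (- x * cosh u) * sinh (\<nu> * u)"
  let ?f = "\<lambda>u. \<nu> * (exp (- x * cosh u) * cosh (\<nu> * u))
    - x / 2 * (exp (- x * cosh u) * cosh ((\<nu> + 1) * u) - exp (- x * cosh u) * cosh ((\<nu> - 1) * u))"
  have int: "set_integrable lborel {0<..} (\<lambda>u. exp (- x * cosh u) * cosh (\<kappa> * u))" for \<kappa>
    by (rule set_integrable_subset[OF set_integrable_besselK[OF assms]]) auto
  have sinh_sinh: "sinh u * sinh (\<nu> * u) = (cosh ((\<nu> + 1) * u) - cosh ((\<nu> - 1) * u)) / 2" for u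
    by (simp add: sinh_field_def cosh_field_def field_simps flip: exp_add)
  have "(LBINT u:{0<..}. ?f u) = 0 - 0"
  proof (rule set_integral_greaterThan_FTC[where F = ?F])
    fix u
    have "(?F has_real_derivative (\<nu> * (exp (- x * cosh u) * cosh (\<nu> * u))
        - x * (exp (- x * cosh u) * (sinh u * sinh (\<nu> * u))))) (at u)"
      by (auto intro!: derivative_eq_intros simp: algebra_simps)
    then show "(?F has_real_derivative ?f u) (at u)"
      by (simp add: sinh_sinh right_diff_distrib diff_divide_distrib)
    show "isCont ?f u"
      by (intro continuous_intros)
  next
    show "set_integrable lborel {0<..} ?f"
      by (intro set_integral_diff(1) set_integrable_mult_right int)
    have "(?F \<longlongrightarrow> ?F 0) (at_right 0)"
      by (intro tendsto_intros)
    then show "(?F \<longlongrightarrow> 0) (at_right 0)"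
      by simp
    let ?b = "\<bar>\<nu>\<bar> + 1"
    show "(?F \<longlongrightarrow> 0) at_top"
    proof (rule tendsto_rabs_zero_cancel, rule tendsto_sandwich)
      show "\<forall>\<^sub>F u in at_top. 0 \<le> \<bar>?F u\<bar>" by simp
      have "\<bar>?F u\<bar> \<le> exp (?b\<^sup>2 / x) * exp (- u)" if "0 \<le> u" for u
      proof -
        have "\<bar>sinh (\<nu> * u)\<bar> = sinh (\<bar>\<nu>\<bar> * u)"
          using that by (simp add: abs_mult flip: sinh_real_abs)
        also have "\<dots> \<le> exp (\<bar>\<nu>\<bar> * u)"
          using sinh_plus_cosh[of "\<bar>\<nu>\<bar> * u"] cosh_real_nonneg[of "\<bar>\<nu>\<bar> * u"] by linarith
        finally have "\<bar>?F u\<bar> \<le> (exp (?b\<^sup>2 / x) * exp (- ?b * u)) * exp (\<bar>\<nu>\<bar> * u)"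
          unfolding abs_mult abs_exp_cancel
          by (intro mult_mono exp_minus_cosh_le assms that) auto
        also have "\<dots> = exp (?b\<^sup>2 / x) * exp (- u)"
          by (simp add: algebra_simps flip: exp_add)
        finally show ?thesis .
      qed
      then show "\<forall>\<^sub>F u in at_top. \<bar>?F u\<bar> \<le> exp (?b\<^sup>2 / x) * exp (- u)"
        by (intro eventually_mono[OF eventually_ge_at_top[of 0]])
      show "((\<lambda>u. exp (?b\<^sup>2 / x) * exp (- u)) \<longlongrightarrow> 0) at_top"
        by (intro tendsto_mult_right_zero filterlim_compose[OF exp_at_bot] filterlim_uminus_at_bot_at_top)
    qed simp
  qed
  moreover have "(LBINT u:{0<..}. ?f u)
      = \<nu> * besselK \<nu> x - x / 2 * (besselK (\<nu> + 1) x - besselK (\<nu> - 1) x)"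
    using int by (simp add: set_integral_diff besselK_greaterThan)
  ultimately show ?thesis
    by simp
qed

text \<open>
  The recurrence cancels the order \<open>\<nu> + 1\<close> from the derivative, so only \<open>\<nu> - 1\<close> is left.
\<close>

lemma has_real_derivative_powr_besselK:
  assumes "0 < x"
  shows "((\<lambda>x. x powr \<nu> * besselK \<nu> x) has_real_derivative - (x powr \<nu> * besselK (\<nu> - 1) x)) (at x)"
proof -
  have "x powr \<nu> * (- (besselK (\<nu> + 1) x + besselK (\<nu> - 1) x) / 2) + \<nu> * x powr (\<nu> - 1) * besselK \<nu> x
      = x powr (\<nu> - 1) / 2 * (2 * \<nu> * besselK \<nu> x - x * (besselK (\<nu> + 1) x + besselK (\<nu> - 1) x))"
    using assms by (simp add: powr_diff field_simps)
  also have "\<dots> = - (x powr \<nu> * besselK (\<nu> - 1) x)"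
    unfolding besselK_recurrence[OF assms, symmetric] using assms by (simp add: powr_diff field_simps)
  finally show ?thesis
    using DERIV_mult[OF has_real_derivative_powr[OF assms, of \<nu>] has_real_derivative_besselK[OF assms, of \<nu>]]
    by (simp add: mult.commute add.commute)
qed

text \<open>
  Unfolding the even integrand to the whole line makes translations of \<open>u\<close> available.
\<close>

section \<open>Behaviour at the origin\<close>

lemma besselK_full_line:
  assumes "0 < x"
  shows "integrable lborel (\<lambda>u. exp (- x * cosh u) * exp (\<nu> * u))" (is "integrable _ ?f")
    and "(LBINT u. exp (- x * cosh u) * exp (\<nu> * u)) = 2 * besselK \<nu> x"
proof -
  define h where "h = (\<lambda>u. indicat_real {0..} u * ?f u)"
  define k where "k = (\<lambda>u. indicat_real {0<..} u * ?f (- u))"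
  have f: "?f = (\<lambda>u. h u + k (0 + (- 1) * u))"
    by (auto simp: h_def k_def indicator_def fun_eq_iff)
  have intf: "set_integrable lborel {0..} ?f" "set_integrable lborel {0..} (\<lambda>u. ?f (- u))"
    using set_integrable_exp_minus_cosh[OF assms, of \<nu>] set_integrable_exp_minus_cosh[OF assms, of "- \<nu>"]
    by auto
  have h: "integrable lborel h"
    using intf(1) by (simp add: set_integrable_def h_def)
  have "set_integrable lborel {0<..} (\<lambda>u. ?f (- u))"
    by (rule set_integrable_subset[OF intf(2)]) auto
  then have k: "integrable lborel k"
    by (simp add: set_integrable_def k_def)
  then have k': "integrable lborel (\<lambda>u. k (0 + (- 1) * u))"
    by (subst lborel_integrable_real_affine_iff) auto
  show "integrable lborel ?f"
    unfolding f using h k' by (rule Bochner_Integration.integrable_add)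
  have "integral\<^sup>L lborel ?f = integral\<^sup>L lborel h + integral\<^sup>L lborel (\<lambda>u. k (0 + (- 1) * u))"
    unfolding f by (rule Bochner_Integration.integral_add[OF h k'])
  also have "integral\<^sup>L lborel (\<lambda>u. k (0 + (- 1) * u)) = integral\<^sup>L lborel k"
    using lborel_integral_real_affine[of "- 1" k 0] by simp
  also have "integral\<^sup>L lborel h + integral\<^sup>L lborel k
      = (LBINT u:{0..}. ?f u) + (LBINT u:{0<..}. ?f (- u))"
    by (simp add: h_def k_def set_lebesgue_integral_def)
  also have "(LBINT u:{0<..}. ?f (- u)) = (LBINT u:{0..}. ?f (- u))"
    by (rule set_integral_discrete_difference[of "{0}"]) auto
  also have "(LBINT u:{0..}. ?f u) + (LBINT u:{0..}. ?f (- u)) = (LBINT u:{0..}. ?f u + ?f (- u))"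
    using intf by (simp only: set_integral_add)
  also have "\<dots> = (LBINT u:{0..}. 2 * (exp (- x * cosh u) * cosh (\<nu> * u)))"
  proof -
    have "?f u + ?f (- u) = 2 * (exp (- x * cosh u) * cosh (\<nu> * u))" for u
      unfolding cosh_field_def[of "\<nu> * u"] by (simp add: field_simps)
    then show ?thesis by simp
  qed
  also have "\<dots> = 2 * besselK \<nu> x"
    unfolding besselK_def by (rule set_integral_mult_right)
  finally show "integral\<^sup>L lborel ?f = 2 * besselK \<nu> x" .
qed

text \<open>
  The translation \<open>u = w + ln (2 / x)\<close> turns \<open>x * cosh u\<close> into \<open>exp w + x\<^sup>2 / 4 * exp (- w)\<close> and
  absorbs the factor \<open>x powr \<nu>\<close>. The resulting integrand increases to its limit as \<open>x\<close>
  decreases to \<open>0\<close>, so the limit dominates it.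
\<close>

lemma powr_besselK_eq:
  assumes "0 < x"
  shows "integrable lborel (\<lambda>w. exp (\<nu> * w - exp w - x\<^sup>2 / 4 * exp (- w)))"
    and "x powr \<nu> * besselK \<nu> x
      = 2 powr (\<nu> - 1) * (LBINT w. exp (\<nu> * w - exp w - x\<^sup>2 / 4 * exp (- w)))"
proof -
  let ?f = "\<lambda>u. exp (- x * cosh u) * exp (\<nu> * u)"
  define t where "t = ln (2 / x)"
  have t: "exp t = 2 / x" "exp (- t) = x / 2" "exp (\<nu> * t) = (2 / x) powr \<nu>"
    using assms by (simp_all add: t_def exp_minus powr_def)
  have eq: "?f (t + 1 * w) = (2 / x) powr \<nu> * exp (\<nu> * w - exp w - x\<^sup>2 / 4 * exp (- w))" for w
  proof -
    have "cosh (t + w) = (exp t * exp w + exp (- t) * exp (- w)) / 2"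
      by (simp add: cosh_field_def flip: exp_add)
    then have "cosh (t + w) = (2 / x * exp w + x / 2 * exp (- w)) / 2"
      by (simp only: t)
    then have "x * cosh (t + w) = exp w + x\<^sup>2 / 4 * exp (- w)"
      using assms by (simp add: field_simps power2_eq_square)
    then have "?f (t + 1 * w) = exp (\<nu> * t) * exp (\<nu> * w - (exp w + x\<^sup>2 / 4 * exp (- w)))"
      by (simp add: algebra_simps flip: exp_add)
    then show ?thesis by (simp add: t(3) diff_diff_eq)
  qed
  have nz: "(2 / x) powr \<nu> \<noteq> 0" using assms by simp
  show "integrable lborel (\<lambda>w. exp (\<nu> * w - exp w - x\<^sup>2 / 4 * exp (- w)))"
    using lborel_integrable_real_affine[OF besselK_full_line(1)[OF assms, of \<nu>], of 1 t] nz
    by (simp only: eq) simp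
  have "2 * besselK \<nu> x = (LBINT w. ?f (t + 1 * w))"
    using lborel_integral_real_affine[of 1 ?f t] besselK_full_line(2)[OF assms, of \<nu>] by simp
  also have "\<dots> = (2 / x) powr \<nu> * (LBINT w. exp (\<nu> * w - exp w - x\<^sup>2 / 4 * exp (- w)))"
    unfolding eq by simp
  finally show "x powr \<nu> * besselK \<nu> x
      = 2 powr (\<nu> - 1) * (LBINT w. exp (\<nu> * w - exp w - x\<^sup>2 / 4 * exp (- w)))"
    using assms by (simp add: powr_divide powr_diff field_simps)
qed

text \<open>
  Euler's integral for \<open>\<Gamma>\<close> after the substitution \<open>t = exp w\<close>.
\<close>

lemma Gamma_exp_integral:
  assumes "0 < (\<nu>::real)"
  shows "integrable lborel (\<lambda>w. exp (\<nu> * w - exp w))"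
    and "(LBINT w. exp (\<nu> * w - exp w)) = Gamma \<nu>"
proof -
  let ?g = "\<lambda>t. exp (\<nu> * ln t - exp (ln t)) * (1 / t)"
  have g_eq: "?g t = t powr (\<nu> - 1) / exp t" if "0 < t" for t
    using that by (simp add: powr_def exp_diff algebra_simps)
  have "has_bochner_integral lborel (\<lambda>t. indicator {0..} t *\<^sub>R (t powr (\<nu> - 1) / exp t)) (Gamma \<nu>)"
    using Gamma_conv_nn_integral_real[OF assms] assms
    by (intro has_bochner_integral_nn_integral) (auto simp: Gamma_real_pos less_imp_le)
  then have si: "set_integrable lborel {0..} (\<lambda>t. t powr (\<nu> - 1) / exp t)"
    and sv: "(LBINT t:{0..}. t powr (\<nu> - 1) / exp t) = Gamma \<nu>"
    by (auto simp: has_bochner_integral_iff set_integrable_def set_lebesgue_integral_def)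
  have si': "set_integrable lborel {0<..} ?g"
  proof -
    have "set_integrable lborel {0<..} (\<lambda>t. t powr (\<nu> - 1) / exp t)"
      by (rule set_integrable_subset[OF si]) auto
    then show ?thesis
      using g_eq by (subst set_integrable_cong) auto
  qed
  note sub = interval_integral_substitution_nonneg[where a = 0 and b = \<infinity> and A = "- \<infinity>" and B = \<infinity>
      and g = ln and g' = "\<lambda>t. 1 / t" and f = "\<lambda>w. exp (\<nu> * w - exp w)"]
  have prems: "(0::ereal) < \<infinity>" 
    "\<And>t. 0 < ereal t \<Longrightarrow> ereal t < \<infinity> \<Longrightarrow> DERIV ln t :> 1 / t"
    "\<And>t. 0 < ereal t \<Longrightarrow> ereal t < \<infinity> \<Longrightarrow> isCont (\<lambda>w. exp (\<nu> * w - exp w)) (ln t)"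
    "\<And>t. 0 < ereal t \<Longrightarrow> ereal t < \<infinity> \<Longrightarrow> isCont (\<lambda>t. 1 / t) t"
    "\<And>t. 0 < ereal t \<Longrightarrow> ereal t < \<infinity> \<Longrightarrow> 0 \<le> exp (\<nu> * ln t - exp (ln t))"
    "\<And>t. 0 \<le> ereal t \<Longrightarrow> ereal t \<le> \<infinity> \<Longrightarrow> 0 \<le> 1 / t"
    "((ereal \<circ> ln \<circ> real_of_ereal) \<longlongrightarrow> - \<infinity>) (at_right 0)"
    "((ereal \<circ> ln \<circ> real_of_ereal) \<longlongrightarrow> \<infinity>) (at_left \<infinity>)"
    "set_integrable lborel (einterval 0 \<infinity>) ?g"
           apply (simp)
          apply (auto intro!: derivative_eq_intros)[1]
         apply (auto intro!: continuous_intros)[1]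
        apply (auto intro!: continuous_intros)[1]
       apply simp
      apply simp
     using ln_at_0 apply (simp add: zero_ereal_def ereal_tendsto_simps)
    using ln_at_top apply (simp add: ereal_tendsto_simps)
   using si' by (simp add: zero_ereal_def)
  show "integrable lborel (\<lambda>w. exp (\<nu> * w - exp w))"
    using sub(1)[OF prems] by (simp add: set_integrable_def)
  have "(LBINT w. exp (\<nu> * w - exp w)) = (LBINT t:{0<..}. ?g t)"
    using sub(2)[OF prems]
    by (simp add: interval_lebesgue_integral_def set_lebesgue_integral_def zero_ereal_def)
  also have "\<dots> = (LBINT t:{0<..}. t powr (\<nu> - 1) / exp t)"
    using g_eq by (intro set_lebesgue_integral_cong) auto
  also have "\<dots> = (LBINT t:{0..}. t powr (\<nu> - 1) / exp t)"
    by (rule set_integral_discrete_difference[of "{0}"]) auto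
  finally show "(LBINT w. exp (\<nu> * w - exp w)) = Gamma \<nu>"
    using sv by simp
qed

lemma powr_besselK_le:
  assumes "0 < \<nu>" "0 < x"
  shows "x powr \<nu> * besselK \<nu> x \<le> 2 powr (\<nu> - 1) * Gamma \<nu>"
  unfolding powr_besselK_eq(2)[OF assms(2)] Gamma_exp_integral(2)[OF assms(1), symmetric]
  by (intro mult_left_mono integral_mono powr_besselK_eq(1) Gamma_exp_integral(1) assms) auto

lemma tendsto_powr_besselK_at_right_0:
  assumes "0 < \<nu>"
  shows "((\<lambda>x. x powr \<nu> * besselK \<nu> x) \<longlongrightarrow> 2 powr (\<nu> - 1) * Gamma \<nu>) (at_right 0)"
  unfolding tendsto_at_iff_sequentially
proof (intro allI impI)
  fix X :: "nat \<Rightarrow> real"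
  assume "\<forall>i. X i \<in> {0<..} - {0}" and X: "X \<longlonglongrightarrow> 0"
  then have pos: "0 < X i" for i by simp
  let ?s = "\<lambda>x w. exp (\<nu> * w - exp w - x\<^sup>2 / 4 * exp (- w))"
  have "(\<lambda>i. LBINT w. ?s (X i) w) \<longlonglongrightarrow> (LBINT w. exp (\<nu> * w - exp w))"
  proof (rule integral_dominated_convergence[where w = "\<lambda>w. exp (\<nu> * w - exp w)"])
    have "(\<lambda>i. ?s (X i) w) \<longlonglongrightarrow> ?s 0 w" for w
      by (intro tendsto_intros X) auto
    then show "AE w in lborel. (\<lambda>i. ?s (X i) w) \<longlonglongrightarrow> exp (\<nu> * w - exp w)"
      by simp
  qed (use Gamma_exp_integral(1)[OF assms] in auto)
  then have "(\<lambda>i. 2 powr (\<nu> - 1) * (LBINT w. ?s (X i) w)) \<longlonglongrightarrow> 2 powr (\<nu> - 1) * Gamma \<nu>"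
    unfolding Gamma_exp_integral(2)[OF assms] by (intro tendsto_intros)
  then show "((\<lambda>x. x powr \<nu> * besselK \<nu> x) \<circ> X) \<longlonglongrightarrow> 2 powr (\<nu> - 1) * Gamma \<nu>"
    by (simp add: comp_def powr_besselK_eq(2)[OF pos])
qed

text \<open>
  A quantitative form of \<open>besselK (\<nu> - 1) x / besselK \<nu> x \<rightarrow> 1\<close> at infinity: raising the order
  by one increases \<open>besselK\<close>, and the recurrence then compares the orders \<open>\<nu>\<close> and \<open>\<nu> - 1\<close>.
\<close>

section \<open>Ratios of Bessel functions\<close>

lemma besselK_recurrence_bound:
  assumes "0 < x" "0 \<le> \<nu>"
  shows "(x - 2 * \<nu>) * besselK \<nu> x \<le> x * besselK (\<nu> - 1) x"
proof -
  have "x * besselK \<nu> x \<le> x * besselK (\<nu> + 1) x"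
    using besselK_strict_mono_order[of x \<nu> "\<nu> + 1"] assms by simp
  then show ?thesis
    using besselK_recurrence[OF assms(1), of \<nu>] by (simp add: algebra_simps)
qed

text \<open>
  That is, \<open>cosh (\<mu> * u) / cosh (\<nu> * u)\<close> decreases in \<open>u \<ge> 0\<close>. By the product formula both sides
  are sums of two values of \<open>cosh\<close>, and their arguments compare pairwise.
\<close>

lemma cosh_cross_mult_less:
  fixes u v :: real
  assumes "\<bar>\<mu>\<bar> < \<bar>\<nu>\<bar>" "0 \<le> u" "u < v"
  shows "cosh (\<mu> * v) * cosh (\<nu> * u) < cosh (\<mu> * u) * cosh (\<nu> * v)"
proof -
  have pos: "cosh (m * v) * cosh (n * u) < cosh (m * u) * cosh (n * v)"
    if "0 \<le> m" "m < n" for m n :: real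
  proof -
    have prod: "2 * (cosh a * cosh b) = cosh (a + b) + cosh (b - a)" for a b :: real
      by (simp add: cosh_add cosh_diff)
    have "0 < (n - m) * (v - u)" "0 < (n - m) * (u + v)" "0 < (n + m) * (v - u)"
      "0 \<le> m * u" "0 \<le> n * v" "0 \<le> m * v" "0 \<le> n * u" "m * u \<le> n * v"
      using that assms by (auto intro!: mult_mono)
    then have "cosh \<bar>m * v + n * u\<bar> < cosh \<bar>m * u + n * v\<bar>" "cosh \<bar>n * u - m * v\<bar> < cosh \<bar>n * v - m * u\<bar>"
      by (auto simp: cosh_real_nonneg_less_iff algebra_simps abs_if)
    then show ?thesis
      using prod[of "m * v" "n * u"] prod[of "m * u" "n * v"] by simp
  qed
  have abs: "cosh (\<bar>\<kappa>\<bar> * w) = cosh (\<kappa> * w)" for \<kappa> w :: real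
    by (simp add: abs_if)
  then show ?thesis
    using pos[OF abs_ge_zero assms(1)] by (simp only: abs)
qed

text \<open>
  Let \<open>r\<close> be the ratio at \<open>x\<close>. The function \<open>d u = cosh (\<mu> * u) - r * cosh (\<nu> * u)\<close> has integral
  zero against \<open>exp (- x * cosh u)\<close> and changes sign exactly once, from positive to negative at
  some \<open>w\<close>. Replacing \<open>x\<close> by \<open>y > x\<close> multiplies the weight by a decreasing function of \<open>u\<close>, which
  favours the positive part of \<open>d\<close>, so the integral becomes positive.
\<close>

lemma besselK_ratio_strict_mono:
  assumes "\<bar>\<mu>\<bar> < \<bar>\<nu>\<bar>" "0 < x" "x < y"
  shows "besselK \<mu> x / besselK \<nu> x < besselK \<mu> y / besselK \<nu> y"
proof -
  have "0 < y" using assms by simp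
  define r where "r = besselK \<mu> x / besselK \<nu> x"
  define d where "d u = cosh (\<mu> * u) - r * cosh (\<nu> * u)" for u
  have int: "set_integrable lborel {0..} (\<lambda>u. exp (- z * cosh u) * d u)"
    and val: "(LBINT u:{0..}. exp (- z * cosh u) * d u) = besselK \<mu> z - r * besselK \<nu> z"
    if "0 < z" for z
  proof -
    have eq: "exp (- z * cosh u) * d u
        = exp (- z * cosh u) * cosh (\<mu> * u) - r * (exp (- z * cosh u) * cosh (\<nu> * u))" for u
      by (simp add: d_def algebra_simps)
    note i = set_integrable_besselK[OF that]
    show "set_integrable lborel {0..} (\<lambda>u. exp (- z * cosh u) * d u)"
      unfolding eq by (intro set_integral_diff(1) set_integrable_mult_right i)
    show "(LBINT u:{0..}. exp (- z * cosh u) * d u) = besselK \<mu> z - r * besselK \<nu> z"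
      unfolding eq besselK_def
      by (simp only: set_integral_diff(2) set_integrable_mult_right i set_integral_mult_right)
  qed
  have zero: "(LBINT u:{0..}. exp (- x * cosh u) * d u) = 0"
    using besselK_pos[OF assms(2), of \<nu>] by (simp only: val[OF assms(2)]) (simp add: r_def)
  have "r < 1"
    using besselK_strict_mono_order[OF assms(2,1)] besselK_pos[OF assms(2)] by (simp add: r_def)
  then have "0 < d 0" by (simp add: d_def)
  \<comment> \<open>If \<open>d\<close> were positive throughout, its integral against the weight at \<open>x\<close> could not vanish.\<close>
  obtain v where v: "0 \<le> v" "d v \<le> 0"
  proof (rule ccontr)
    assume "\<not> thesis"
    then have "0 < d u" if "0 \<le> u" for u
      using that \<open>\<And>v. 0 \<le> v \<Longrightarrow> d v \<le> 0 \<Longrightarrow> thesis\<close> by fastforce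
    then have "0 < (LBINT u:{0..}. exp (- x * cosh u) * d u)"
      by (intro set_lebesgue_integral_strict_pos[where a = 0 and b = 1] int assms) (auto simp: less_imp_le)
    then show False using zero by simp
  qed
  have "continuous_on {0..v} d"
    unfolding d_def by (intro continuous_intros)
  then obtain w where w: "0 \<le> w" "d w = 0"
    using IVT2'[of d v 0 0] v \<open>0 < d 0\<close> by auto
  have before: "0 < d u" if "0 \<le> u" "u < w" for u
  proof -
    have "r * cosh (\<nu> * u) * cosh (\<nu> * w) < cosh (\<mu> * u) * cosh (\<nu> * w)"
      using cosh_cross_mult_less[OF assms(1) that] w(2) by (simp add: d_def ac_simps)
    then show ?thesis by (simp add: d_def)
  qed
  have after: "d u < 0" if "w < u" for u
  proof -
    have "cosh (\<mu> * u) * cosh (\<nu> * w) < r * cosh (\<nu> * u) * cosh (\<nu> * w)"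
      using cosh_cross_mult_less[OF assms(1) w(1) that] w(2) by (simp add: d_def ac_simps)
    then show ?thesis by (simp add: d_def)
  qed
  \<comment> \<open>Subtracting \<open>k\<close> times the vanishing integral at \<open>x\<close>, with \<open>k\<close> the value at \<open>w\<close> of the quotient
    of the two weights, makes the integrand nonnegative.\<close>
  define k where "k = exp (- (y - x) * cosh w)"
  let ?h = "\<lambda>u. exp (- y * cosh u) * d u - k * (exp (- x * cosh u) * d u)"
  have h: "?h u = exp (- x * cosh u) * ((exp (- (y - x) * cosh u) - k) * d u)" for u
    by (simp add: algebra_simps flip: exp_add)
  have "0 < ?h u" if u: "0 \<le> u" "u \<noteq> w" for u
  proof (cases "u < w")
    case True
    then have "cosh u < cosh w"
      using u by (simp add: cosh_real_nonneg_less_iff)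
    then have "k < exp (- (y - x) * cosh u)"
      using assms by (simp add: k_def)
    then show ?thesis
      unfolding h using before[OF u(1) True] by (intro mult_pos_pos) auto
  next
    case False
    then have "w < u" using u by simp
    moreover from this have "cosh w < cosh u"
      using w by (simp add: cosh_real_nonneg_less_iff)
    then have "exp (- (y - x) * cosh u) < k"
      using assms by (simp add: k_def)
    ultimately show ?thesis
      unfolding h using after by (intro mult_pos_pos mult_neg_neg) auto
  qed
  moreover have "?h w = 0" by (simp add: w)
  ultimately have nonneg: "0 \<le> ?h u" if "0 \<le> u" for u
    using that by (cases "u = w") (auto simp: less_imp_le)
  have "0 < (LBINT u:{0..}. ?h u)"
  proof (rule set_lebesgue_integral_strict_pos[where a = w and b = "w + 1"])
    show "set_integrable lborel {0..} ?h"
      by (intro set_integral_diff(1) set_integrable_mult_right int assms \<open>0 < y\<close>)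
  qed (use nonneg \<open>\<And>u. \<lbrakk>0 \<le> u; u \<noteq> w\<rbrakk> \<Longrightarrow> 0 < ?h u\<close> w in auto)
  also have "(LBINT u:{0..}. ?h u) = besselK \<mu> y - r * besselK \<nu> y"
    using int[OF assms(2)] int[OF \<open>0 < y\<close>]
    by (simp only: set_integral_diff(2) set_integrable_mult_right set_integral_mult_right zero
        val[OF \<open>0 < y\<close>])
  finally show ?thesis
    using besselK_pos[OF \<open>0 < y\<close>, of \<nu>] by (simp add: r_def[symmetric] less_divide_eq)
qed

text \<open>
  A bound uniform on \<open>t \<ge> x\<close> for an exponent \<open>a\<close> of either sign; for \<open>a > 0\<close> it is the tangent
  inequality \<open>ln (s * t) \<le> s * t - 1\<close> with slope \<open>s = \<delta> / a\<close>.
\<close>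

section \<open>The weighted Bessel function and its tails\<close>

lemma powr_le_const_exp:
  fixes a x \<delta> :: real
  assumes "0 < x" "0 < \<delta>"
  obtains C where "0 \<le> C" "\<And>t. x \<le> t \<Longrightarrow> t powr a \<le> C * exp (\<delta> * t)"
proof (cases "a \<le> 0")
  case True
  show ?thesis
  proof (rule that[of "x powr a"])
    fix t assume "x \<le> t"
    then have "t powr a \<le> x powr a" "1 \<le> exp (\<delta> * t)"
      using True assms by (auto intro: powr_mono2')
    then show "t powr a \<le> x powr a * exp (\<delta> * t)"
      using mult_mono[of "t powr a" "x powr a" 1 "exp (\<delta> * t)"] by simp
  qed simp
next
  case False
  define s where "s = \<delta> / a"
  have s: "0 < s" "a * s = \<delta>" using False assms by (auto simp: s_def)
  show ?thesis
  proof (rule that[of "exp (- a * ln s)"])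
    fix t assume t: "x \<le> t"
    then have "ln (s * t) \<le> s * t"
      using ln_le_minus_one[of "s * t"] s assms by simp
    then have "a * (ln s + ln t) \<le> a * (s * t)"
      using s t assms False by (intro mult_left_mono) (auto simp: ln_mult)
    then have "a * ln t \<le> - a * ln s + \<delta> * t"
      unfolding s(2)[symmetric] by (simp add: algebra_simps)
    then show "t powr a \<le> exp (- a * ln s) * exp (\<delta> * t)"
      using t assms by (simp add: powr_def flip: exp_add)
  qed simp
qed

text \<open>
  The power \<open>a\<close> is kept independent of the order \<open>\<nu>\<close>, because differentiation lowers the order
  but leaves the power unchanged.
\<close>

definition weighted_besselK :: "real \<Rightarrow> real \<Rightarrow> real \<Rightarrow> real \<Rightarrow> real" where
  "weighted_besselK \<beta> a \<nu> t = exp (\<beta> * t) * t powr a * besselK \<nu> t"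

lemma weighted_besselK_pos: "0 < t \<Longrightarrow> 0 < weighted_besselK \<beta> a \<nu> t"
  by (simp add: weighted_besselK_def besselK_pos)

lemma isCont_weighted_besselK:
  assumes "0 < t"
  shows "isCont (weighted_besselK \<beta> a \<nu>) t"
  unfolding weighted_besselK_def[abs_def]
  using assms DERIV_isCont[OF has_real_derivative_besselK[OF assms]]
  by (intro continuous_intros) auto

lemma borel_measurable_weighted_besselK:
  assumes "A \<subseteq> {0<..}" "A \<in> sets borel"
  shows "set_borel_measurable lborel A (weighted_besselK \<beta> a \<nu>)"
proof -
  have "set_borel_measurable borel A (weighted_besselK \<beta> a \<nu>)"
    using assms by (intro set_measurable_continuous_on continuous_at_imp_continuous_on)
      (auto intro: isCont_weighted_besselK)
  then show ?thesis
    by (simp add: set_borel_measurable_def)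
qed

lemma weighted_besselK_exponential_decay:
  assumes "\<beta> < 1" "0 < x"
  obtains C where "\<And>t. x \<le> t \<Longrightarrow> weighted_besselK \<beta> a \<nu> t \<le> C * exp (- ((1 - \<beta>) / 2) * t)"
proof -
  define \<delta> where "\<delta> = (1 - \<beta>) / 2"
  have "0 < \<delta>" using assms by (simp add: \<delta>_def)
  from powr_le_const_exp[OF assms(2) this]
  obtain C where C: "0 \<le> C" "\<And>t. x \<le> t \<Longrightarrow> t powr a \<le> C * exp (\<delta> * t)"
    by blast
  have K0: "0 \<le> besselK \<nu> t" if "x \<le> t" for t
    using besselK_pos[of t \<nu>] that assms by simp
  show ?thesis
  proof (rule that[of "C * (exp x * besselK \<nu> x)"])
    fix t assume t: "x \<le> t"
    have "weighted_besselK \<beta> a \<nu> t \<le> exp (\<beta> * t) * (C * exp (\<delta> * t)) * (exp (x - t) * besselK \<nu> x)"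
      unfolding weighted_besselK_def
      using t C assms K0[of t] by (intro mult_mono besselK_exponential_decay) auto
    also have "\<dots> = C * (exp x * besselK \<nu> x) * exp (\<beta> * t + \<delta> * t - t)"
      by (simp add: exp_add exp_diff exp_minus field_simps)
    also have "\<beta> * t + \<delta> * t - t = - ((1 - \<beta>) / 2) * t"
      by (simp add: \<delta>_def field_simps)
    finally show "weighted_besselK \<beta> a \<nu> t \<le> C * (exp x * besselK \<nu> x) * exp (- ((1 - \<beta>) / 2) * t)" .
  qed
qed

lemma set_integrable_weighted_besselK:
  assumes "\<beta> < 1" "0 < x"
  shows "set_integrable lborel {x<..} (weighted_besselK \<beta> a \<nu>)"
proof -
  from weighted_besselK_exponential_decay[OF assms]
  obtain C where C: "\<And>t. x \<le> t \<Longrightarrow> weighted_besselK \<beta> a \<nu> t \<le> C * exp (- ((1 - \<beta>) / 2) * t)"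
    by blast
  have "set_integrable lborel {x..} (\<lambda>t. C * exp (- ((1 - \<beta>) / 2) * t))"
    using assms by (intro set_integrable_mult_right set_integrable_exp_minus) auto
  then have "set_integrable lborel {x<..} (\<lambda>t. C * exp (- ((1 - \<beta>) / 2) * t))"
    by (rule set_integrable_subset) auto
  then show ?thesis
  proof (rule set_integrable_bound)
    show "AE t in lborel. t \<in> {x<..} \<longrightarrow>
        norm (weighted_besselK \<beta> a \<nu> t) \<le> norm (C * exp (- ((1 - \<beta>) / 2) * t))"
    proof (intro AE_I2 impI)
      fix t assume "t \<in> {x<..}"
      then have "0 < weighted_besselK \<beta> a \<nu> t" "weighted_besselK \<beta> a \<nu> t \<le> C * exp (- ((1 - \<beta>) / 2) * t)"
        using weighted_besselK_pos[of t] C[of t] assms by auto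
      then show "norm (weighted_besselK \<beta> a \<nu> t) \<le> norm (C * exp (- ((1 - \<beta>) / 2) * t))"
        unfolding real_norm_def by linarith
    qed
  qed (use assms in \<open>auto intro!: borel_measurable_weighted_besselK\<close>)
qed

lemma weighted_besselK_tendsto_0:
  assumes "\<beta> < 1"
  shows "(weighted_besselK \<beta> a \<nu> \<longlongrightarrow> 0) at_top"
proof -
  from weighted_besselK_exponential_decay[OF assms zero_less_one]
  obtain C where C: "\<And>t. 1 \<le> t \<Longrightarrow> weighted_besselK \<beta> a \<nu> t \<le> C * exp (- ((1 - \<beta>) / 2) * t)"
    by blast
  show ?thesis
  proof (rule tendsto_sandwich)
    show "\<forall>\<^sub>F t in at_top. 0 \<le> weighted_besselK \<beta> a \<nu> t"
      by (rule eventually_mono[OF eventually_gt_at_top[of 0]]) (simp add: weighted_besselK_pos less_imp_le)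
    show "\<forall>\<^sub>F t in at_top. weighted_besselK \<beta> a \<nu> t \<le> C * exp (- ((1 - \<beta>) / 2) * t)"
      by (rule eventually_mono[OF eventually_ge_at_top[of 1]]) (rule C)
    show "((\<lambda>t. C * exp (- ((1 - \<beta>) / 2) * t)) \<longlongrightarrow> 0) at_top"
      using assms
      by (intro tendsto_mult_right_zero filterlim_compose[OF exp_at_bot]
          filterlim_tendsto_neg_mult_at_bot[OF tendsto_const _ filterlim_ident]) auto
  qed simp
qed

lemma has_real_derivative_weighted_besselK:
  assumes "0 < t"
  shows "(weighted_besselK \<beta> \<nu> \<nu> has_real_derivative
    \<beta> * weighted_besselK \<beta> \<nu> \<nu> t - weighted_besselK \<beta> \<nu> (\<nu> - 1) t) (at t)"
proof -
  have "((\<lambda>t. exp (\<beta> * t)) has_real_derivative exp (\<beta> * t) * \<beta>) (at t)"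
    by (auto intro!: derivative_eq_intros)
  from DERIV_mult[OF this has_real_derivative_powr_besselK[OF assms, of \<nu>]] show ?thesis
    by (simp add: weighted_besselK_def[abs_def] algebra_simps)
qed

text \<open>
  The key identity: the derivative of the weighted function with equal power and order, multiplied
  by \<open>c\<close>, is integrated over the half line and added to the tail. The left endpoint enters through
  the limit \<open>A\<close> alone, which covers \<open>x > 0\<close> and \<open>x = 0\<close> together.
\<close>

lemma set_integral_weighted_besselK_FTC:
  fixes c :: real
  assumes "0 \<le> x"
    and "set_integrable lborel {x<..} (weighted_besselK \<beta> \<nu> \<nu>)"
    and "set_integrable lborel {x<..} (weighted_besselK \<beta> \<nu> (\<nu> - 1))"
    and "(weighted_besselK \<beta> \<nu> \<nu> \<longlongrightarrow> A) (at_right x)"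
    and "\<beta> < 1"
  shows "(LBINT t:{x<..}. (1 + c * \<beta>) * weighted_besselK \<beta> \<nu> \<nu> t - c * weighted_besselK \<beta> \<nu> (\<nu> - 1) t)
    = (LBINT t:{x<..}. weighted_besselK \<beta> \<nu> \<nu> t) - c * A"
proof -
  let ?d = "\<lambda>t. \<beta> * weighted_besselK \<beta> \<nu> \<nu> t - weighted_besselK \<beta> \<nu> (\<nu> - 1) t"
  have d: "set_integrable lborel {x<..} ?d"
    by (intro set_integral_diff(1) set_integrable_mult_right assms)
  have "(LBINT t:{x<..}. ?d t) = 0 - A"
    using assms
    by (intro set_integral_greaterThan_FTC[where F = "weighted_besselK \<beta> \<nu> \<nu>", OF _ _ d] weighted_besselK_tendsto_0
        has_real_derivative_weighted_besselK continuous_intros isCont_weighted_besselK) auto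
  moreover have "(LBINT t:{x<..}. weighted_besselK \<beta> \<nu> \<nu> t + c * ?d t)
      = (LBINT t:{x<..}. weighted_besselK \<beta> \<nu> \<nu> t) + c * (LBINT t:{x<..}. ?d t)"
    using assms(2) d by (simp only: set_integral_add(2) set_integrable_mult_right set_integral_mult_right)
  ultimately show ?thesis
    by (simp add: algebra_simps)
qed

lemma tendsto_set_integral_greaterThan:
  fixes f :: "real \<Rightarrow> real"
  assumes "set_integrable lborel {a<..} f"
  shows "((\<lambda>x. LBINT t:{x<..}. f t) \<longlongrightarrow> (LBINT t:{a<..}. f t)) (at_right a)"
  unfolding tendsto_at_iff_sequentially
proof (intro allI impI)
  fix X :: "nat \<Rightarrow> real"
  assume "\<forall>i. X i \<in> {a<..} - {a}" and X: "X \<longlonglongrightarrow> a"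
  then have gt: "a < X i" for i by simp
  let ?f = "\<lambda>t. indicat_real {a<..} t *\<^sub>R f t"
  have int: "integrable lborel ?f"
    using assms by (simp add: set_integrable_def)
  have eq: "indicat_real {X i<..} t *\<^sub>R f t = indicat_real {X i<..} t *\<^sub>R ?f t" for i t
    using gt[of i] by (auto simp: indicator_def)
  have "(\<lambda>i. LBINT t. indicat_real {X i<..} t *\<^sub>R ?f t) \<longlonglongrightarrow> (LBINT t. ?f t)"
  proof (rule integral_dominated_convergence[where w = "\<lambda>t. \<bar>?f t\<bar>"])
    have "(\<lambda>i. indicat_real {X i<..} t *\<^sub>R ?f t) \<longlonglongrightarrow> ?f t" for t
    proof (cases "a < t")
      case True
      then have "\<forall>\<^sub>F i in sequentially. X i < t"
        using X by (simp add: order_tendstoD)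
      then have "\<forall>\<^sub>F i in sequentially. indicat_real {X i<..} t *\<^sub>R ?f t = ?f t"
        by eventually_elim simp
      then show ?thesis
        by (rule tendsto_eventually)
    qed simp
    then show "AE t in lborel. (\<lambda>i. indicat_real {X i<..} t *\<^sub>R ?f t) \<longlonglongrightarrow> ?f t"
      by simp
    show "integrable lborel (\<lambda>t. \<bar>?f t\<bar>)"
      using int by (rule integrable_abs)
    show "?f \<in> borel_measurable lborel"
      using int by (rule borel_measurable_integrable)
    then show "(\<lambda>t. indicat_real {X i<..} t *\<^sub>R ?f t) \<in> borel_measurable lborel" for i
      by measurable
    show "AE t in lborel. norm (indicat_real {X i<..} t *\<^sub>R ?f t) \<le> \<bar>?f t\<bar>" for i
      by (auto simp: indicator_def)
  qed
  then show "((\<lambda>x. LBINT t:{x<..}. f t) \<circ> X) \<longlonglongrightarrow> (LBINT t:{a<..}. f t)"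
    by (simp only: set_lebesgue_integral_def comp_def eq)
qed

lemma weighted_besselK_tendsto_at_right_0:
  assumes "0 < \<nu>"
  shows "(weighted_besselK \<beta> \<nu> \<nu> \<longlongrightarrow> 2 powr (\<nu> - 1) * Gamma \<nu>) (at_right 0)"
proof -
  have "((\<lambda>t. exp (\<beta> * t)) \<longlongrightarrow> exp (\<beta> * 0)) (at_right 0)"
    by (intro tendsto_intros)
  from tendsto_mult[OF this tendsto_powr_besselK_at_right_0[OF assms]]
  show ?thesis
    by (simp add: weighted_besselK_def[abs_def] mult.assoc)
qed

text \<open>
  Near the origin \<open>t powr \<nu> * besselK \<nu> t\<close> is bounded by its limit at \<open>0\<close>.
\<close>

lemma set_integrable_weighted_besselK_0:
  assumes "\<beta> < 1" "0 < \<nu>"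
  shows "set_integrable lborel {0<..} (weighted_besselK \<beta> \<nu> \<nu>)"
proof -
  let ?M = "exp \<bar>\<beta>\<bar> * (2 powr (\<nu> - 1) * Gamma \<nu>)"
  have "set_integrable lborel {0<..1} (\<lambda>t::real. ?M)"
    by (simp add: set_integrable_def)
  then have "set_integrable lborel {0<..1} (weighted_besselK \<beta> \<nu> \<nu>)"
  proof (rule set_integrable_bound)
    have "norm (weighted_besselK \<beta> \<nu> \<nu> t) \<le> norm ?M" if t: "t \<in> {0<..1}" for t
    proof -
      have "\<beta> * t \<le> \<bar>\<beta>\<bar> * 1"
        using t by (intro mult_mono) auto
      moreover have "0 \<le> t powr \<nu> * besselK \<nu> t"
        using t besselK_pos[of t \<nu>] by simp
      ultimately have "exp (\<beta> * t) * (t powr \<nu> * besselK \<nu> t) \<le> ?M"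
        using t assms powr_besselK_le[of \<nu> t] by (intro mult_mono[of "exp (\<beta> * t)" "exp \<bar>\<beta>\<bar>"]) auto
      moreover have "0 < weighted_besselK \<beta> \<nu> \<nu> t"
        using t by (intro weighted_besselK_pos) simp
      ultimately show ?thesis
        by (simp add: weighted_besselK_def mult.assoc)
    qed
    then show "AE t in lborel. t \<in> {0<..1} \<longrightarrow> norm (weighted_besselK \<beta> \<nu> \<nu> t) \<le> norm ?M"
      by blast
  qed (auto intro!: borel_measurable_weighted_besselK)
  from set_integrable_Un[OF this set_integrable_weighted_besselK[OF assms(1) zero_less_one]]
  show ?thesis
    by (simp add: ivl_disj_un)
qed

section \<open>Comparison of tails with the weighted function\<close>

lemma weighted_besselK_less_order:
  assumes "\<bar>\<mu>\<bar> < \<bar>\<nu>\<bar>" "0 < t"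
  shows "weighted_besselK \<beta> a \<mu> t < weighted_besselK \<beta> a \<nu> t"
  using assms besselK_strict_mono_order[OF assms(2,1)] by (simp add: weighted_besselK_def)

lemma weighted_besselK_half:
  "weighted_besselK \<beta> a (1/2 - 1) t = weighted_besselK \<beta> a (1/2) t"
  using besselK_minus[of "1/2" t] by (simp add: weighted_besselK_def)

text \<open>
  For \<open>\<nu> \<ge> 1/2\<close> one has \<open>\<bar>\<nu> - 1\<bar> \<le> \<nu>\<close>, so the shifted order is dominated by the original one.
\<close>

lemma set_integrable_weighted_besselK_shifted_0:
  assumes "\<beta> < 1" "1/2 \<le> \<nu>"
  shows "set_integrable lborel {0<..} (weighted_besselK \<beta> \<nu> (\<nu> - 1))"
proof (rule set_integrable_bound)
  show "set_integrable lborel {0<..} (weighted_besselK \<beta> \<nu> \<nu>)"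
    using assms by (intro set_integrable_weighted_besselK_0) auto
  have "norm (weighted_besselK \<beta> \<nu> (\<nu> - 1) t) \<le> norm (weighted_besselK \<beta> \<nu> \<nu> t)"
    if t: "t \<in> {0<..}" for t
  proof -
    have "weighted_besselK \<beta> \<nu> (\<nu> - 1) t \<le> weighted_besselK \<beta> \<nu> \<nu> t"
    proof (cases "\<nu> = 1/2")
      case True
      then show ?thesis by (simp only: weighted_besselK_half order_refl)
    next
      case False
      then show ?thesis
        using weighted_besselK_less_order[of "\<nu> - 1" \<nu> t] assms t by (simp add: less_imp_le)
    qed
    moreover have "0 < weighted_besselK \<beta> \<nu> (\<nu> - 1) t"
      using t by (intro weighted_besselK_pos) simp
    ultimately show ?thesis by simp
  qed
  then show "AE t in lborel. t \<in> {0<..} \<longrightarrow>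
      norm (weighted_besselK \<beta> \<nu> (\<nu> - 1) t) \<le> norm (weighted_besselK \<beta> \<nu> \<nu> t)"
    by blast
qed (auto intro!: borel_measurable_weighted_besselK)

lemma tail_minus_weighted_besselK:
  assumes "\<beta> < 1" "0 < x"
  shows "(LBINT t:{x<..}. weighted_besselK \<beta> \<nu> \<nu> t) - c * weighted_besselK \<beta> \<nu> \<nu> x
    = (LBINT t:{x<..}. (1 + c * \<beta>) * weighted_besselK \<beta> \<nu> \<nu> t - c * weighted_besselK \<beta> \<nu> (\<nu> - 1) t)"
proof (rule set_integral_weighted_besselK_FTC[symmetric])
  show "(weighted_besselK \<beta> \<nu> \<nu> \<longlongrightarrow> weighted_besselK \<beta> \<nu> \<nu> x) (at_right x)"
    using isCont_weighted_besselK[OF assms(2)] by (simp add: isCont_def filterlim_at_split)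
qed (use assms in \<open>auto intro!: set_integrable_weighted_besselK\<close>)

lemma set_integrable_tail_integrand:
  assumes "\<beta> < 1" "0 < x"
  shows "set_integrable lborel {x<..}
    (\<lambda>t. p * weighted_besselK \<beta> a \<nu> t - q * weighted_besselK \<beta> b \<mu> t)"
  using assms by (intro set_integral_diff(1) set_integrable_mult_right set_integrable_weighted_besselK)

lemma set_integral_greaterThan_pos:
  fixes f :: "real \<Rightarrow> real"
  assumes "set_integrable lborel {x<..} f" "\<And>t. x < t \<Longrightarrow> 0 < f t"
  shows "0 < (LBINT t:{x<..}. f t)"
  by (rule set_lebesgue_integral_strict_pos[where a = x and b = "x + 1"])
    (use assms in \<open>auto simp: less_imp_le\<close>)

text \<open>
  The constant \<open>1 / (1 - \<beta>)\<close> is the one for which the two coefficients in the key identity agree, so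
  that the sign is decided by comparing the orders \<open>\<nu>\<close> and \<open>\<nu> - 1\<close>.
\<close>

lemma tail_minus_lower_bound:
  assumes "\<beta> < 1" "0 < x"
  shows "(LBINT t:{x<..}. weighted_besselK \<beta> \<nu> \<nu> t) - 1 / (1 - \<beta>) * weighted_besselK \<beta> \<nu> \<nu> x
    = 1 / (1 - \<beta>) * (LBINT t:{x<..}. weighted_besselK \<beta> \<nu> \<nu> t - weighted_besselK \<beta> \<nu> (\<nu> - 1) t)"
proof -
  have "1 + 1 / (1 - \<beta>) * \<beta> = 1 / (1 - \<beta>)"
    using assms by (simp add: field_simps)
  then show ?thesis
    unfolding tail_minus_weighted_besselK[OF assms] set_integral_mult_right[symmetric]
    by (simp only: right_diff_distrib)
qed

lemma tail_weighted_besselK_less: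
  assumes "\<beta> < 1" "0 < x" "\<nu> < 1/2"
  shows "(LBINT t:{x<..}. weighted_besselK \<beta> \<nu> \<nu> t) < 1 / (1 - \<beta>) * weighted_besselK \<beta> \<nu> \<nu> x"
proof -
  note int = set_integrable_weighted_besselK[OF assms(1,2)]
  have "0 < (LBINT t:{x<..}. weighted_besselK \<beta> \<nu> (\<nu> - 1) t - weighted_besselK \<beta> \<nu> \<nu> t)"
    using assms
    by (intro set_integral_greaterThan_pos set_integral_diff(1) int) (auto intro!: weighted_besselK_less_order)
  then have "(LBINT t:{x<..}. weighted_besselK \<beta> \<nu> \<nu> t - weighted_besselK \<beta> \<nu> (\<nu> - 1) t) < 0"
    using int by (simp add: set_integral_diff)
  then have "1 / (1 - \<beta>) * (LBINT t:{x<..}. weighted_besselK \<beta> \<nu> \<nu> t - weighted_besselK \<beta> \<nu> (\<nu> - 1) t) < 0"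
    using assms by (intro mult_pos_neg) auto
  then show ?thesis
    using tail_minus_lower_bound[OF assms(1,2), of \<nu>] by linarith
qed

lemma tail_weighted_besselK_greater:
  assumes "\<beta> < 1" "0 < x" "1/2 < \<nu>"
  shows "1 / (1 - \<beta>) * weighted_besselK \<beta> \<nu> \<nu> x < (LBINT t:{x<..}. weighted_besselK \<beta> \<nu> \<nu> t)"
proof -
  note int = set_integrable_weighted_besselK[OF assms(1,2)]
  have "0 < (LBINT t:{x<..}. weighted_besselK \<beta> \<nu> \<nu> t - weighted_besselK \<beta> \<nu> (\<nu> - 1) t)"
    using assms
    by (intro set_integral_greaterThan_pos set_integral_diff(1) int) (auto intro!: weighted_besselK_less_order)
  then have "0 < 1 / (1 - \<beta>) * (LBINT t:{x<..}. weighted_besselK \<beta> \<nu> \<nu> t - weighted_besselK \<beta> \<nu> (\<nu> - 1) t)"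
    using assms by (intro mult_pos_pos) auto
  then show ?thesis
    using tail_minus_lower_bound[OF assms(1,2), of \<nu>] by linarith
qed

lemma tail_weighted_besselK_half:
  assumes "\<beta> < 1" "0 < x"
  shows "(LBINT t:{x<..}. weighted_besselK \<beta> (1/2) (1/2) t) = 1 / (1 - \<beta>) * weighted_besselK \<beta> (1/2) (1/2) x"
  using tail_minus_lower_bound[OF assms, of "1/2"] by (simp only: weighted_besselK_half) simp

lemma besselK_const_eq:
  "besselK_const \<nu> \<beta> = (LBINT t:{0<..}. weighted_besselK \<beta> \<nu> \<nu> t)"
  by (simp add: besselK_const_def weighted_besselK_def)

text \<open>
  The limit as \<open>x\<close> tends to \<open>0\<close> of the tail integral divided by the weighted function.
\<close>

definition origin_ratio :: "real \<Rightarrow> real \<Rightarrow> real" where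
  "origin_ratio \<beta> \<nu> = besselK_const \<nu> \<beta> / (2 powr (\<nu> - 1) * Gamma \<nu>)"

lemma origin_ratio_mult:
  assumes "0 < \<nu>"
  shows "origin_ratio \<beta> \<nu> * (2 powr (\<nu> - 1) * Gamma \<nu>) = besselK_const \<nu> \<beta>"
  using Gamma_real_pos[OF assms] by (simp add: origin_ratio_def)

lemma origin_ratio_pos:
  assumes "\<beta> < 1" "0 < \<nu>"
  shows "0 < origin_ratio \<beta> \<nu>"
proof -
  have "0 < besselK_const \<nu> \<beta>"
    unfolding besselK_const_eq
    by (intro set_integral_greaterThan_pos set_integrable_weighted_besselK_0 assms weighted_besselK_pos)
  then show ?thesis
    using Gamma_real_pos[OF assms(2)] by (simp add: origin_ratio_def)
qed

lemma integral_weighted_besselK_origin: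
  assumes "\<beta> < 1" "1/2 \<le> \<nu>"
  shows "(LBINT t:{0<..}. (1 + c * \<beta>) * weighted_besselK \<beta> \<nu> \<nu> t - c * weighted_besselK \<beta> \<nu> (\<nu> - 1) t)
    = besselK_const \<nu> \<beta> - c * (2 powr (\<nu> - 1) * Gamma \<nu>)"
  unfolding besselK_const_eq
  using assms
  by (intro set_integral_weighted_besselK_FTC weighted_besselK_tendsto_at_right_0
      set_integrable_weighted_besselK_0 set_integrable_weighted_besselK_shifted_0) auto

text \<open>
  At \<open>\<nu> = 1/2\<close> the orders \<open>\<nu>\<close> and \<open>\<nu> - 1\<close> give the same function, so the tail is an exact multiple
  of the weighted function and the constants of the upper and lower bounds coincide.
\<close>

lemma origin_ratio_half:
  assumes "\<beta> < 1"
  shows "origin_ratio \<beta> (1/2) = 1 / (1 - \<beta>)"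
proof -
  let ?c = "1 / (1 - \<beta>)"
  have c: "1 + ?c * \<beta> = ?c"
    using assms by (simp add: field_simps)
  have "(LBINT t:{0<..}. (1 + ?c * \<beta>) * weighted_besselK \<beta> (1/2) (1/2) t
      - ?c * weighted_besselK \<beta> (1/2) (1/2 - 1) t) = 0"
    unfolding c weighted_besselK_half by simp
  then have "besselK_const (1/2) \<beta> = ?c * (2 powr (1/2 - 1) * Gamma (1/2))"
    using integral_weighted_besselK_origin[OF assms, of "1/2" ?c] by simp
  moreover have "0 < Gamma (1/2 :: real)"
    by (rule Gamma_real_pos) simp
  then have "Gamma (1/2 :: real) \<noteq> 0"
    by (rule less_imp_neq[THEN not_sym])
  ultimately show ?thesis
    by (simp add: origin_ratio_def)
qed

text \<open>
  The integrand \<open>\<phi>\<close> of the key identity is the weighted function times a strictly decreasing factor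
  \<open>p\<close>, and has total integral zero. If \<open>p x \<le> 0\<close>, then \<open>\<phi>\<close> is negative on the whole tail; otherwise
  it is positive on \<open>(0, x]\<close>, and the tail integral is minus the integral over \<open>(0, x]\<close>.
\<close>

lemma tail_weighted_besselK_upper:
  assumes "\<beta> < 1" "0 < x" "1/2 < \<nu>"
  shows "(LBINT t:{x<..}. weighted_besselK \<beta> \<nu> \<nu> t) < origin_ratio \<beta> \<nu> * weighted_besselK \<beta> \<nu> \<nu> x"
proof -
  define C where "C = origin_ratio \<beta> \<nu>"
  define \<phi> where "\<phi> t = (1 + C * \<beta>) * weighted_besselK \<beta> \<nu> \<nu> t - C * weighted_besselK \<beta> \<nu> (\<nu> - 1) t" for t
  define p where "p t = 1 + C * \<beta> - C * (besselK (\<nu> - 1) t / besselK \<nu> t)" for t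
  have "0 < C"
    using origin_ratio_pos[of \<beta> \<nu>] assms by (simp add: C_def)
  have \<phi>_eq: "\<phi> t = weighted_besselK \<beta> \<nu> \<nu> t * p t" if "0 < t" for t
    using besselK_pos[OF that, of \<nu>] by (simp add: \<phi>_def p_def weighted_besselK_def field_simps)
  have p_anti: "p t < p s" if "0 < s" "s < t" for s t
  proof -
    have "\<bar>\<nu> - 1\<bar> < \<bar>\<nu>\<bar>" using assms by linarith
    from mult_strict_left_mono[OF besselK_ratio_strict_mono[OF this that] \<open>0 < C\<close>]
    show ?thesis unfolding p_def by linarith
  qed
  have int0: "set_integrable lborel {0<..} \<phi>"
    unfolding \<phi>_def using assms
    by (intro set_integral_diff(1) set_integrable_mult_right set_integrable_weighted_besselK_0
        set_integrable_weighted_besselK_shifted_0) auto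
  have int: "set_integrable lborel {x<..} \<phi>"
    by (rule set_integrable_subset[OF int0]) (use assms in auto)
  have total: "(LBINT t:{0<..}. \<phi> t) = 0"
    unfolding \<phi>_def using assms integral_weighted_besselK_origin[of \<beta> \<nu> C] origin_ratio_mult[of \<nu> \<beta>]
    by (simp add: C_def)
  have "(LBINT t:{x<..}. \<phi> t) < 0"
  proof (cases "p x \<le> 0")
    case True
    have "0 < - \<phi> t" if "x < t" for t
      using that assms True p_anti[of x t] weighted_besselK_pos[of t \<beta> \<nu> \<nu>]
      by (simp add: \<phi>_eq mult_pos_neg)
    then have "0 < (LBINT t:{x<..}. - \<phi> t)"
      using int set_integrable_mult_right[of "- 1" lborel "{x<..}" \<phi>]
      by (intro set_integral_greaterThan_pos) auto
    then show ?thesis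
      using set_integral_uminus[OF int] by simp
  next
    case False
    have "0 < \<phi> t" if "0 < t" "t \<le> x" for t
      using that False p_anti[of t x] weighted_besselK_pos[of t \<beta> \<nu> \<nu>]
      by (cases "t = x") (auto simp: \<phi>_eq)
    moreover have intl: "set_integrable lborel {0<..x} \<phi>"
      by (rule set_integrable_subset[OF int0]) auto
    ultimately have "0 < (LBINT t:{0<..x}. \<phi> t)"
      using assms by (intro set_lebesgue_integral_strict_pos[where a = 0 and b = x]) (auto simp: less_imp_le)
    moreover have "(LBINT t:{0<..x} \<union> {x<..}. \<phi> t) = (LBINT t:{0<..x}. \<phi> t) + (LBINT t:{x<..}. \<phi> t)"
      by (rule set_integral_Un) (use intl int in auto)
    moreover have "{0<..x} \<union> {x<..} = {0<..}"
      using assms by auto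
    ultimately show ?thesis
      using total by simp
  qed
  then show ?thesis
    using tail_minus_weighted_besselK[OF assms(1,2), of \<nu> C] unfolding \<phi>_def C_def by linarith
qed

text \<open>
  If \<open>c * (1 - \<beta>) > 1\<close>, then \<open>1 + c * \<beta> < c\<close>, and since the ratio of the orders \<open>\<nu> - 1\<close> and \<open>\<nu>\<close> is at
  least \<open>1 - 2 * \<nu> / t\<close>, the integrand of the key identity is negative for all large \<open>t\<close>.
\<close>

lemma tail_weighted_besselK_lower_sharp:
  assumes "\<beta> < 1" "0 \<le> \<nu>" "1 / (1 - \<beta>) < c"
  obtains x where "0 < x"
    "(LBINT t:{x<..}. weighted_besselK \<beta> \<nu> \<nu> t) < c * weighted_besselK \<beta> \<nu> \<nu> x"
proof -
  have "0 < 1 / (1 - \<beta>)" using assms by simp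
  then have "0 < c" using assms(3) by linarith
  define e where "e = c * (1 - \<beta>) - 1"
  have "0 < e" using assms by (simp add: e_def field_simps)
  \<comment> \<open>Beyond \<open>2 * \<nu> * c / e\<close> the error term \<open>2 * \<nu> * c / t\<close> is smaller than the surplus \<open>e\<close>.\<close>
  define x where "x = 2 * \<nu> * c / e + 1"
  have "0 < x"
    using assms \<open>0 < c\<close> \<open>0 < e\<close> by (simp add: x_def add_nonneg_pos)
  let ?\<phi> = "\<lambda>t. c * weighted_besselK \<beta> \<nu> (\<nu> - 1) t - (1 + c * \<beta>) * weighted_besselK \<beta> \<nu> \<nu> t"
  have "0 < ?\<phi> t" if "x < t" for t
  proof -
    have t: "0 < t" using that \<open>0 < x\<close> by simp
    have "2 * \<nu> * c / e < t" using that by (simp add: x_def)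
    then have "2 * \<nu> * c < t * e" using \<open>0 < e\<close> by (simp add: divide_less_eq)
    then have "(1 + c * \<beta>) * t < c * (t - 2 * \<nu>)"
      by (simp add: e_def algebra_simps)
    from mult_strict_right_mono[OF this besselK_pos[OF t, of \<nu>]]
    have "(1 + c * \<beta>) * t * besselK \<nu> t < c * ((t - 2 * \<nu>) * besselK \<nu> t)"
      by (simp add: mult.assoc)
    also have "\<dots> \<le> c * (t * besselK (\<nu> - 1) t)"
      using \<open>0 < c\<close> besselK_recurrence_bound[OF t assms(2)] by simp
    finally have "t * ((1 + c * \<beta>) * besselK \<nu> t) < t * (c * besselK (\<nu> - 1) t)"
      by (simp add: ac_simps)
    then have "(1 + c * \<beta>) * besselK \<nu> t < c * besselK (\<nu> - 1) t"
      using t by simp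
    then have "0 < exp (\<beta> * t) * t powr \<nu> * (c * besselK (\<nu> - 1) t - (1 + c * \<beta>) * besselK \<nu> t)"
      using t by simp
    then show ?thesis
      by (simp add: weighted_besselK_def algebra_simps)
  qed
  then have "0 < (LBINT t:{x<..}. ?\<phi> t)"
    using \<open>0 < x\<close> assms by (intro set_integral_greaterThan_pos set_integrable_tail_integrand)
  then have "(LBINT t:{x<..}. (1 + c * \<beta>) * weighted_besselK \<beta> \<nu> \<nu> t - c * weighted_besselK \<beta> \<nu> (\<nu> - 1) t) < 0"
    using set_integral_uminus[OF set_integrable_tail_integrand[OF assms(1) \<open>0 < x\<close>], of c \<nu> "\<nu> - 1" "1 + c * \<beta>" \<nu> \<nu>]
    by simp
  then show ?thesis
    using that[OF \<open>0 < x\<close>] tail_minus_weighted_besselK[OF assms(1) \<open>0 < x\<close>, of \<nu> c] by linarith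
qed

lemma tail_weighted_besselK_upper_sharp:
  assumes "\<beta> < 1" "0 < \<nu>" "c < origin_ratio \<beta> \<nu>"
  obtains x where "0 < x"
    "c * weighted_besselK \<beta> \<nu> \<nu> x < (LBINT t:{x<..}. weighted_besselK \<beta> \<nu> \<nu> t)"
proof -
  let ?L = "2 powr (\<nu> - 1) * Gamma \<nu>"
  have "c * ?L < origin_ratio \<beta> \<nu> * ?L"
    using assms Gamma_real_pos[of \<nu>] by (intro mult_strict_right_mono) auto
  then have "0 < besselK_const \<nu> \<beta> - c * ?L"
    using origin_ratio_mult[OF assms(2)] by simp
  moreover have "((\<lambda>x. (LBINT t:{x<..}. weighted_besselK \<beta> \<nu> \<nu> t) - c * weighted_besselK \<beta> \<nu> \<nu> x)
      \<longlongrightarrow> besselK_const \<nu> \<beta> - c * ?L) (at_right 0)"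
    unfolding besselK_const_eq
    by (intro tendsto_intros tendsto_set_integral_greaterThan set_integrable_weighted_besselK_0
        weighted_besselK_tendsto_at_right_0 assms)
  ultimately have "\<forall>\<^sub>F x in at_right 0.
      0 < (LBINT t:{x<..}. weighted_besselK \<beta> \<nu> \<nu> t) - c * weighted_besselK \<beta> \<nu> \<nu> x"
    by (rule order_tendstoD(1)[rotated])
  then have "\<exists>x>0. 0 < (LBINT t:{x<..}. weighted_besselK \<beta> \<nu> \<nu> t) - c * weighted_besselK \<beta> \<nu> \<nu> x"
    unfolding eventually_at_right_field by (meson dense)
  then show ?thesis
    using that by auto
qed

lemma tail_weighted_besselK_shifted:
  assumes "\<beta> < 1" "0 < x"
  shows "(LBINT t:{x<..}. weighted_besselK \<beta> \<nu> (\<nu> - 1) t)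
    = weighted_besselK \<beta> \<nu> \<nu> x + \<beta> * (LBINT t:{x<..}. weighted_besselK \<beta> \<nu> \<nu> t)"
proof -
  note int = set_integrable_weighted_besselK[OF assms]
  have "(LBINT t:{x<..}. (1 + 1 * \<beta>) * weighted_besselK \<beta> \<nu> \<nu> t - 1 * weighted_besselK \<beta> \<nu> (\<nu> - 1) t)
      = (1 + \<beta>) * (LBINT t:{x<..}. weighted_besselK \<beta> \<nu> \<nu> t) - (LBINT t:{x<..}. weighted_besselK \<beta> \<nu> (\<nu> - 1) t)"
    using int by (simp add: set_integral_diff)
  then show ?thesis
    using tail_minus_weighted_besselK[OF assms, of \<nu> 1] by (simp add: algebra_simps)
qed

section \<open>The tail of shifted order and the main result\<close>

lemma tail_shifted_minus_weighted_besselK: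
  assumes "\<beta> < 1" "0 < x"
  shows "(LBINT t:{x<..}. weighted_besselK \<beta> \<nu> (\<nu> - 1) t) - (1 + \<beta> * d) * weighted_besselK \<beta> \<nu> \<nu> x
    = \<beta> * ((LBINT t:{x<..}. weighted_besselK \<beta> \<nu> \<nu> t) - d * weighted_besselK \<beta> \<nu> \<nu> x)"
  unfolding tail_weighted_besselK_shifted[OF assms] by (simp add: algebra_simps)

text \<open>
  Bounding the tail of order \<open>\<nu> - 1\<close> by \<open>1 + \<beta> * d\<close> is the same as bounding that of order \<open>\<nu>\<close> by \<open>d\<close>,
  so that the bounds, their strictness and their optimality all transfer.
\<close>

lemma tail_shifted_less_iff:
  fixes \<beta> \<nu> x d :: real
  assumes "0 < \<beta>" "\<beta> < 1" "0 < x"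
  defines "F \<equiv> LBINT t:{x<..}. weighted_besselK \<beta> \<nu> \<nu> t"
    and "G \<equiv> LBINT t:{x<..}. weighted_besselK \<beta> \<nu> (\<nu> - 1) t"
    and "f \<equiv> weighted_besselK \<beta> \<nu> \<nu> x"
  shows "G < (1 + \<beta> * d) * f \<longleftrightarrow> F < d * f" "(1 + \<beta> * d) * f < G \<longleftrightarrow> d * f < F"
proof -
  have eq: "G - (1 + \<beta> * d) * f = \<beta> * (F - d * f)"
    unfolding F_def G_def f_def by (rule tail_shifted_minus_weighted_besselK[OF assms(2,3)])
  have "G < (1 + \<beta> * d) * f \<longleftrightarrow> \<beta> * (F - d * f) < 0" "(1 + \<beta> * d) * f < G \<longleftrightarrow> 0 < \<beta> * (F - d * f)"
    unfolding eq[symmetric] by auto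
  then show "G < (1 + \<beta> * d) * f \<longleftrightarrow> F < d * f" "(1 + \<beta> * d) * f < G \<longleftrightarrow> d * f < F"
    using assms(1) by (auto simp: mult_less_0_iff zero_less_mult_iff)
qed

theorem theorem2p2:
  fixes \<beta> :: real
  assumes "0 < \<beta>" and "\<beta> < 1"
  shows
    "(\<forall>x>0. \<forall>\<nu>::real.
        (\<nu> \<le> 1/2 \<longrightarrow>
          (LBINT t:{x<..}. exp (\<beta> * t) * t powr \<nu> * besselK \<nu> t)
            \<le> 1 / (1 - \<beta>) * (exp (\<beta> * x) * x powr \<nu> * besselK \<nu> x) \<and>
          ((LBINT t:{x<..}. exp (\<beta> * t) * t powr \<nu> * besselK \<nu> t)
            = 1 / (1 - \<beta>) * (exp (\<beta> * x) * x powr \<nu> * besselK \<nu> x) \<longleftrightarrow> \<nu> = 1/2)) \<and>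
        (\<nu> > 1/2 \<longrightarrow>
          (LBINT t:{x<..}. exp (\<beta> * t) * t powr \<nu> * besselK \<nu> t)
            \<ge> 1 / (1 - \<beta>) * (exp (\<beta> * x) * x powr \<nu> * besselK \<nu> x))) \<and>
      (\<forall>\<nu>::real. \<nu> > 1/2 \<longrightarrow>
        (\<forall>x>0.
          1 / (1 - \<beta>) * (exp (\<beta> * x) * x powr \<nu> * besselK \<nu> x)
            < (LBINT t:{x<..}. exp (\<beta> * t) * t powr \<nu> * besselK \<nu> t) \<and>
          (LBINT t:{x<..}. exp (\<beta> * t) * t powr \<nu> * besselK \<nu> t)
            < besselK_const \<nu> \<beta> / (2 powr (\<nu> - 1) * Gamma \<nu>)
                * (exp (\<beta> * x) * x powr \<nu> * besselK \<nu> x)) \<and>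
        (\<forall>c > 1 / (1 - \<beta>). \<not> (\<forall>x>0.
          c * (exp (\<beta> * x) * x powr \<nu> * besselK \<nu> x)
            < (LBINT t:{x<..}. exp (\<beta> * t) * t powr \<nu> * besselK \<nu> t))) \<and>
        (\<forall>c < besselK_const \<nu> \<beta> / (2 powr (\<nu> - 1) * Gamma \<nu>). \<not> (\<forall>x>0.
          (LBINT t:{x<..}. exp (\<beta> * t) * t powr \<nu> * besselK \<nu> t)
            < c * (exp (\<beta> * x) * x powr \<nu> * besselK \<nu> x)))) \<and>
      (\<forall>\<nu>::real. \<nu> \<ge> -1/2 \<longrightarrow>
        (\<forall>x>0.
          1 / (1 - \<beta>) * (exp (\<beta> * x) * x powr (\<nu> + 1) * besselK (\<nu> + 1) x)
            \<le> (LBINT t:{x<..}. exp (\<beta> * t) * t powr (\<nu> + 1) * besselK \<nu> t) \<and>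
          (1 / (1 - \<beta>) * (exp (\<beta> * x) * x powr (\<nu> + 1) * besselK (\<nu> + 1) x)
            = (LBINT t:{x<..}. exp (\<beta> * t) * t powr (\<nu> + 1) * besselK \<nu> t)
            \<longleftrightarrow> \<nu> = -1/2) \<and>
          (LBINT t:{x<..}. exp (\<beta> * t) * t powr (\<nu> + 1) * besselK \<nu> t)
            \<le> (1 + \<beta> * besselK_const (\<nu> + 1) \<beta> / (2 powr \<nu> * Gamma (\<nu> + 1)))
                * (exp (\<beta> * x) * x powr (\<nu> + 1) * besselK (\<nu> + 1) x) \<and>
          (\<nu> \<noteq> -1/2 \<longrightarrow>
            (LBINT t:{x<..}. exp (\<beta> * t) * t powr (\<nu> + 1) * besselK \<nu> t)
              < (1 + \<beta> * besselK_const (\<nu> + 1) \<beta> / (2 powr \<nu> * Gamma (\<nu> + 1)))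
                  * (exp (\<beta> * x) * x powr (\<nu> + 1) * besselK (\<nu> + 1) x))) \<and>
        (\<forall>c > 1 / (1 - \<beta>). \<not> (\<forall>x>0.
          c * (exp (\<beta> * x) * x powr (\<nu> + 1) * besselK (\<nu> + 1) x)
            \<le> (LBINT t:{x<..}. exp (\<beta> * t) * t powr (\<nu> + 1) * besselK \<nu> t))) \<and>
        (\<forall>c < 1 + \<beta> * besselK_const (\<nu> + 1) \<beta> / (2 powr \<nu> * Gamma (\<nu> + 1)). \<not> (\<forall>x>0.
          (LBINT t:{x<..}. exp (\<beta> * t) * t powr (\<nu> + 1) * besselK \<nu> t)
            \<le> c * (exp (\<beta> * x) * x powr (\<nu> + 1) * besselK (\<nu> + 1) x))))"
proof -
  note W = weighted_besselK_def
  let ?d = "1 / (1 - \<beta>)"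
  have d: "?d = 1 + \<beta> * ?d"
    using assms by (simp add: field_simps)
  have R: "1 + \<beta> * besselK_const (\<nu> + 1) \<beta> / (2 powr \<nu> * Gamma (\<nu> + 1))
      = 1 + \<beta> * origin_ratio \<beta> (\<nu> + 1)" for \<nu>
    by (simp add: origin_ratio_def)
  define F where "F \<nu> x = (LBINT t:{x<..}. exp (\<beta> * t) * t powr \<nu> * besselK \<nu> t)" for \<nu> x
  define f where "f \<nu> x = exp (\<beta> * x) * x powr \<nu> * besselK \<nu> x" for \<nu> x
  define G where "G \<nu> x = (LBINT t:{x<..}. exp (\<beta> * t) * t powr (\<nu> + 1) * besselK \<nu> t)" for \<nu> x
  have F_eq: "F \<nu> x = (LBINT t:{x<..}. weighted_besselK \<beta> \<nu> \<nu> t)" for \<nu> x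
    by (simp add: F_def W)
  have G_eq: "G \<nu> x = (LBINT t:{x<..}. weighted_besselK \<beta> (\<nu> + 1) (\<nu> + 1 - 1) t)" for \<nu> x
    by (simp add: G_def W)
  have f_eq: "f \<nu> x = weighted_besselK \<beta> \<nu> \<nu> x" for \<nu> x
    by (simp add: f_def W)
  note eqs = F_eq G_eq f_eq
  have cmp: "G \<nu> x < (1 + \<beta> * c) * f (\<nu> + 1) x \<longleftrightarrow> F (\<nu> + 1) x < c * f (\<nu> + 1) x"
    "(1 + \<beta> * c) * f (\<nu> + 1) x < G \<nu> x \<longleftrightarrow> c * f (\<nu> + 1) x < F (\<nu> + 1) x" if "0 < x" for \<nu> x c
    unfolding eqs by (rule tail_shifted_less_iff[OF assms that])+
  have F_less: "F \<nu> x < ?d * f \<nu> x" if "0 < x" "\<nu> < 1/2" for \<nu> x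
    unfolding eqs using assms that by (intro tail_weighted_besselK_less)
  have F_half: "F (1/2) x = ?d * f (1/2) x" if "0 < x" for x
    unfolding eqs using assms that by (intro tail_weighted_besselK_half)
  have F_greater: "?d * f \<nu> x < F \<nu> x" if "0 < x" "1/2 < \<nu>" for \<nu> x
    unfolding eqs using assms that by (intro tail_weighted_besselK_greater)
  have F_upper: "F \<nu> x < origin_ratio \<beta> \<nu> * f \<nu> x" if "0 < x" "1/2 < \<nu>" for \<nu> x
    unfolding eqs using assms that by (intro tail_weighted_besselK_upper)
  have lower_sharp: "\<exists>x>0. F \<nu> x < c * f \<nu> x" if "1/2 \<le> \<nu>" "?d < c" for \<nu> c
    unfolding eqs using that by (auto intro: tail_weighted_besselK_lower_sharp[OF assms(2), of \<nu> c])
  have upper_sharp: "\<exists>x>0. c * f \<nu> x < F \<nu> x" if "1/2 \<le> \<nu>" "c < origin_ratio \<beta> \<nu>" for \<nu> c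
    unfolding eqs using that by (auto intro: tail_weighted_besselK_upper_sharp[OF assms(2), of \<nu> c])

  have part1: "(\<nu> \<le> 1/2 \<longrightarrow> F \<nu> x \<le> ?d * f \<nu> x \<and> (F \<nu> x = ?d * f \<nu> x \<longleftrightarrow> \<nu> = 1/2)) \<and>
      (\<nu> > 1/2 \<longrightarrow> F \<nu> x \<ge> ?d * f \<nu> x)" if "0 < x" for \<nu> x
  proof (cases \<nu> "1/2 :: real" rule: linorder_cases)
    case less
    then show ?thesis using F_less[OF that less] by simp
  next
    case equal
    have "F \<nu> x = ?d * f \<nu> x"
      unfolding equal by (rule F_half[OF that])
    then show ?thesis unfolding equal by simp
  next
    case greater
    then show ?thesis using F_greater[OF that greater] by simp
  qed
  have part2: "(\<forall>x>0. ?d * f \<nu> x < F \<nu> x \<and> F \<nu> x < origin_ratio \<beta> \<nu> * f \<nu> x) \<and>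
      (\<forall>c > ?d. \<not> (\<forall>x>0. c * f \<nu> x < F \<nu> x)) \<and>
      (\<forall>c < origin_ratio \<beta> \<nu>. \<not> (\<forall>x>0. F \<nu> x < c * f \<nu> x))" if "1/2 < \<nu>" for \<nu>
  proof (intro conjI allI impI)
    fix c assume "?d < c"
    then show "\<not> (\<forall>x>0. c * f \<nu> x < F \<nu> x)"
      using lower_sharp[of \<nu> c] that by (metis less_imp_le order_less_asym)
  next
    fix c assume "c < origin_ratio \<beta> \<nu>"
    then show "\<not> (\<forall>x>0. F \<nu> x < c * f \<nu> x)"
      using upper_sharp[of \<nu> c] that by (metis less_imp_le order_less_asym)
  qed (use F_greater F_upper that in auto)
  have part3: "(\<forall>x>0. ?d * f (\<nu> + 1) x \<le> G \<nu> x \<and> (?d * f (\<nu> + 1) x = G \<nu> x \<longleftrightarrow> \<nu> = -1/2) \<and>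
        G \<nu> x \<le> (1 + \<beta> * origin_ratio \<beta> (\<nu> + 1)) * f (\<nu> + 1) x \<and>
        (\<nu> \<noteq> -1/2 \<longrightarrow> G \<nu> x < (1 + \<beta> * origin_ratio \<beta> (\<nu> + 1)) * f (\<nu> + 1) x)) \<and>
      (\<forall>c > ?d. \<not> (\<forall>x>0. c * f (\<nu> + 1) x \<le> G \<nu> x)) \<and>
      (\<forall>c < 1 + \<beta> * origin_ratio \<beta> (\<nu> + 1). \<not> (\<forall>x>0. G \<nu> x \<le> c * f (\<nu> + 1) x))"
    if \<nu>: "-1/2 \<le> \<nu>" for \<nu>
  proof -
    \<comment> \<open>A constant \<open>c\<close> for the shifted tail corresponds to \<open>(c - 1) / \<beta>\<close> for the original one.\<close>
    have c: "c = 1 + \<beta> * ((c - 1) / \<beta>)" for c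
      using assms by simp
    have "?d * f (\<nu> + 1) x \<le> G \<nu> x \<and> (?d * f (\<nu> + 1) x = G \<nu> x \<longleftrightarrow> \<nu> = -1/2) \<and>
        G \<nu> x \<le> (1 + \<beta> * origin_ratio \<beta> (\<nu> + 1)) * f (\<nu> + 1) x \<and>
        (\<nu> \<noteq> -1/2 \<longrightarrow> G \<nu> x < (1 + \<beta> * origin_ratio \<beta> (\<nu> + 1)) * f (\<nu> + 1) x)" if "0 < x" for x
    proof (cases "\<nu> = -1/2")
      case True
      then have half': "\<nu> + 1 = 1/2" by simp
      have "G \<nu> x = ?d * f (\<nu> + 1) x"
        using cmp(1)[OF that, of \<nu> ?d] cmp(2)[OF that, of ?d \<nu>] F_half[OF that] unfolding d[symmetric] half' by linarith
      moreover have "1 + \<beta> * origin_ratio \<beta> (\<nu> + 1) = ?d"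
        unfolding half' origin_ratio_half[OF assms(2)] by (rule d[symmetric])
      ultimately show ?thesis using True by simp
    next
      case False
      then have "1/2 < \<nu> + 1" using \<nu> by simp
      then have "?d * f (\<nu> + 1) x < G \<nu> x"
        "G \<nu> x < (1 + \<beta> * origin_ratio \<beta> (\<nu> + 1)) * f (\<nu> + 1) x"
        using cmp(2)[OF that, of ?d \<nu>] cmp(1)[OF that, of \<nu> "origin_ratio \<beta> (\<nu> + 1)"]
          F_greater[OF that] F_upper[OF that] unfolding d[symmetric] by blast+
      then show ?thesis using False by auto
    qed
    moreover have "\<not> (\<forall>x>0. c * f (\<nu> + 1) x \<le> G \<nu> x)" if "?d < c" for c
    proof -
      have "?d < (c - 1) / \<beta>"
        unfolding pos_less_divide_eq[OF assms(1)] using that d mult.commute[of ?d \<beta>] by linarith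
      then obtain x where x: "0 < x" "F (\<nu> + 1) x < (c - 1) / \<beta> * f (\<nu> + 1) x"
        using lower_sharp[of "\<nu> + 1" "(c - 1) / \<beta>"] \<nu> by auto
      then have "G \<nu> x < c * f (\<nu> + 1) x"
        by (subst c) (simp only: cmp)
      then show ?thesis using x(1) by (auto simp: not_le)
    qed
    moreover have "\<not> (\<forall>x>0. G \<nu> x \<le> c * f (\<nu> + 1) x)" if "c < 1 + \<beta> * origin_ratio \<beta> (\<nu> + 1)" for c
    proof -
      have "(c - 1) / \<beta> < origin_ratio \<beta> (\<nu> + 1)"
        unfolding pos_divide_less_eq[OF assms(1)]
        using that mult.commute[of "origin_ratio \<beta> (\<nu> + 1)" \<beta>] by linarith
      then obtain x where x: "0 < x" "(c - 1) / \<beta> * f (\<nu> + 1) x < F (\<nu> + 1) x"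
        using upper_sharp[of "\<nu> + 1" "(c - 1) / \<beta>"] \<nu> by auto
      then have "c * f (\<nu> + 1) x < G \<nu> x"
        by (subst c) (simp only: cmp)
      then show ?thesis using x(1) by (auto simp: not_le)
    qed
    ultimately show ?thesis by blast
  qed
  show ?thesis
    unfolding F_def[symmetric] G_def[symmetric]
    unfolding R f_def[symmetric] origin_ratio_def[symmetric]
    by (rule conjI[OF _ conjI]; intro allI impI; erule part1 part2 part3)
qed

end
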